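(* Let $[(A,\alpha),(C,\gamma)]_\psi$ be a Hom-entwining structure and let $(\mathcal{C},\chi)=(A\otimes C,\alpha\otimes\gamma)$ be the associated $(A,\alpha)$-Hom-coring. Let $Hom^{\mathcal{H}}(C,A)$ be the $k$-module of morphisms $(C,\gamma)\to(A,\alpha)$ in $\widetilde{\mathcal{H}}(\mathcal{M}_k)$. Then the Koppinen smash, or $\psi$-twisted convolution algebra, $Hom^{\mathcal{H}}_\psi(C,A)=(Hom^{\mathcal{H}}(C,A),*_\psi,\eta_A\circ\varepsilon_C)$, where $$(f*_\psi g)(c)=f(c_2)_\kappa\, g(c_1{}^\kappa)\qquad (f,g\in Hom^{\mathcal{H}}(C,A),\ c\in C)$$ and $(\eta_A\circ\varepsilon_C)(c)=\varepsilon_C(c)1_A$ is its unit, is anti-isomorphic to the associative unital algebra $({}^*\mathcal{C},*^l,\varepsilon_{\mathcal{C}})$, where ${}^*\mathcal{C}$ is the $k$-module of left $(A,\alpha)$-linear morphisms $\xi:(\mathcal{C},\chi)\to(A,\alpha)$ and $(\xi*^l\xi')(x)=\xi(x_1\xi'(x_2))$ for $x\in\mathcal{C}$.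
   Context: $k$ is a commutative ring with unit; unadorned $\otimes$ is over $k$. The category $\widetilde{\mathcal{H}}(\mathcal{M}_k)$ has as objects pairs $(M,\mu)$ with $M$ a $k$-module and $\mu$ a $k$-linear automorphism of $M$; morphisms $(M,\mu)\to(N,\nu)$ are $k$-linear maps $f$ with $\nu\circ f=f\circ\mu$; $(M,\mu)\otimes(N,\nu)=(M\otimes N,\mu\otimes\nu)$. A monoidal Hom-algebra $(A,\alpha)$ is an object of $\widetilde{\mathcal{H}}(\mathcal{M}_k)$ with a $k$-linear multiplication and an element $1=1_A$ such that $\alpha(a)(bc)=(ab)\alpha(c)$, $a1_A=1_Aa=\alpha(a)$, $\alpha(ab)=\alpha(a)\alpha(b)$, $\alpha(1_A)=1_A$; $\eta_A:k\to A$ is $x\mapsto x1_A$. A monoidal Hom-coalgebra $(C,\gamma)$ is an object of $\widetilde{\mathcal{H}}(\mathcal{M}_k)$ with $k$-linear maps $\Delta(c)=c_1\otimes c_2$ (summation understood) and $\varepsilon=\varepsilon_C:C\to k$ such that $\gamma^{-1}(c_1)\otimes\Delta(c_2)=c_{11}\otimes(c_{12}\otimes\gamma^{-1}(c_2))$, $\varepsilon(c_1)c_2=\gamma^{-1}(c)=c_1\varepsilon(c_2)$ (ordinary scalar multiplication), $\Delta(\gamma(c))=\gamma(c_1)\otimes\gamma(c_2)$, $\varepsilon(\gamma(c))=\varepsilon(c)$. A (right-right) Hom-entwining structure $[(A,\alpha),(C,\gamma)]_\psi$ consists of a monoidal Hom-algebra $(A,\alpha)$, a monoidal Hom-coalgebra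 $(C,\gamma)$ and a morphism $\psi:C\otimes A\to A\otimes C$ in $\widetilde{\mathcal{H}}(\mathcal{M}_k)$, written $\psi(c\otimes a)=a_\kappa\otimes c^\kappa$ (summation understood; further letters $\lambda,\dots$ for further applications of $\psi$), such that for all $a,a'\in A$, $c\in C$: $(aa')_\kappa\otimes\gamma(c)^\kappa=a_\kappa a'_\lambda\otimes\gamma(c^{\kappa\lambda})$; $\alpha^{-1}(a_\kappa)\otimes c^\kappa{}_1\otimes c^\kappa{}_2=\alpha^{-1}(a)_{\kappa\lambda}\otimes c_1{}^\lambda\otimes c_2{}^\kappa$; $1_\kappa\otimes c^\kappa=1\otimes c$; $a_\kappa\varepsilon(c^\kappa)=a\varepsilon(c)$. The associated $(A,\alpha)$-Hom-coring is $(\mathcal{C},\chi)=(A\otimes C,\alpha\otimes\gamma)$ with left and right $(A,\alpha)$-actions $a(a'\otimes c)=\alpha^{-1}(a)a'\otimes\gamma(c)$ and $(a'\otimes c)a=a'\alpha^{-1}(a)_\kappa\otimes\gamma(c^\kappa)$, comultiplication $\Delta_{\mathcal{C}}(a\otimes c)=(\alpha^{-1}(a)\otimes c_1)\otimes_A(1\otimes c_2)$, written $x\mapsto x_1\otimes_A x_2$, and counit $\varepsilon_{\mathcal{C}}(a\otimes c)=\alpha(a)\varepsilon(c)$. Here, for a right Hom-module $(M,\mu)$ and left Hom-module $(N,\nu)$ over $(A,\alpha)$, $M\otimes_AN$ is the quotient of $M\otimes N$ by the relations $ma\otimes n=\mu(m)\otimes a\nu^{-1}(n)$. A left $(A,\alpha)$-linear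 morphism $\xi:(\mathcal{C},\chi)\to(A,\alpha)$ is a $k$-linear map with $\xi(ax)=a\xi(x)$ and $\xi\circ\chi=\alpha\circ\xi$. An anti-isomorphism of algebras is a $k$-linear bijection that preserves units and reverses products. *)

theory Defs
  imports "HOL-Algebra.Module" "HOL-Algebra.AbelCoset"
begin

text \<open>
  Modules, algebras and coalgebras are HOL-Algebra records over a commutative ring \<open>K\<close>
  (the zero ring is allowed).  Where only the module structure matters, the
  fields \<open>mult\<close> and \<open>one\<close> of the record are left undefined and never used.
  Maps are HOL functions that matter only on carriers; wherever a set of maps is itself the
  carrier of a module, its elements are extensional, so that equality is equality on the carrier.
\<close>

section \<open>Linear maps, quotients and tensor products\<close>

definition ring_as_module :: "'k ring \<Rightarrow> ('k, 'k) module" where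
  "ring_as_module K = \<lparr>carrier = carrier K, mult = mult K, one = one K, zero = zero K,
     add = add K, smult = mult K\<rparr>"

definition linear_maps ::
  "'k ring \<Rightarrow> ('k, 'm) module \<Rightarrow> ('k, 'n) module \<Rightarrow> ('m \<Rightarrow> 'n) set" where
  "linear_maps K M N = {f \<in> carrier M \<rightarrow> carrier N.
     (\<forall>x\<in>carrier M. \<forall>y\<in>carrier M. f (x \<oplus>\<^bsub>M\<^esub> y) = f x \<oplus>\<^bsub>N\<^esub> f y) \<and>
     (\<forall>r\<in>carrier K. \<forall>x\<in>carrier M. f (r \<odot>\<^bsub>M\<^esub> x) = r \<odot>\<^bsub>N\<^esub> f x)}"

definition bilinear_maps ::
  "'k ring \<Rightarrow> ('k, 'm) module \<Rightarrow> ('k, 'n) module \<Rightarrow> ('k, 'p) module \<Rightarrow> ('m \<Rightarrow> 'n \<Rightarrow> 'p) set" where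
  "bilinear_maps K M N P = {b.
     (\<forall>x\<in>carrier M. (\<lambda>y. b x y) \<in> linear_maps K N P) \<and>
     (\<forall>y\<in>carrier N. (\<lambda>x. b x y) \<in> linear_maps K M P)}"

definition submodule_span :: "'k ring \<Rightarrow> ('k, 'm) module \<Rightarrow> 'm set \<Rightarrow> 'm set" where
  "submodule_span K M S = \<Inter>{H. submodule H K M \<and> S \<subseteq> H}"

definition quot_module :: "('k, 'm) module \<Rightarrow> 'm set \<Rightarrow> ('k, 'm set) module" where
  "quot_module M N = \<lparr>carrier = a_rcosets\<^bsub>M\<^esub> N, mult = undefined, one = undefined,
     zero = N, add = set_add M, smult = (\<lambda>r X. \<Union>x\<in>X. N +>\<^bsub>M\<^esub> (r \<odot>\<^bsub>M\<^esub> x))\<rparr>"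

definition free_module :: "'k ring \<Rightarrow> 's set \<Rightarrow> ('k, 's \<Rightarrow> 'k) module" where
  "free_module K S =
     \<lparr>carrier = {F \<in> S \<rightarrow>\<^sub>E carrier K. finite {s \<in> S. F s \<noteq> \<zero>\<^bsub>K\<^esub>}},
      mult = undefined, one = undefined, zero = (\<lambda>s\<in>S. \<zero>\<^bsub>K\<^esub>),
      add = (\<lambda>F G. \<lambda>s\<in>S. F s \<oplus>\<^bsub>K\<^esub> G s), smult = (\<lambda>r F. \<lambda>s\<in>S. r \<otimes>\<^bsub>K\<^esub> F s)\<rparr>"

definition free_gen :: "'k ring \<Rightarrow> 's set \<Rightarrow> 's \<Rightarrow> ('s \<Rightarrow> 'k)" where
  "free_gen K S s = (\<lambda>t\<in>S. if t = s then \<one>\<^bsub>K\<^esub> else \<zero>\<^bsub>K\<^esub>)"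

definition tensor_rels ::
  "'k ring \<Rightarrow> ('k, 'm) module \<Rightarrow> ('k, 'n) module \<Rightarrow> ('m \<times> 'n \<Rightarrow> 'k) set" where
  "tensor_rels K M N =
    (let F = free_module K (carrier M \<times> carrier N); g = free_gen K (carrier M \<times> carrier N) in
      {g (x \<oplus>\<^bsub>M\<^esub> x', y) \<ominus>\<^bsub>F\<^esub> (g (x, y) \<oplus>\<^bsub>F\<^esub> g (x', y)) | x x' y.
         x \<in> carrier M \<and> x' \<in> carrier M \<and> y \<in> carrier N} \<union>
      {g (x, y \<oplus>\<^bsub>N\<^esub> y') \<ominus>\<^bsub>F\<^esub> (g (x, y) \<oplus>\<^bsub>F\<^esub> g (x, y')) | x y y'.
         x \<in> carrier M \<and> y \<in> carrier N \<and> y' \<in> carrier N} \<union>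
      {g (r \<odot>\<^bsub>M\<^esub> x, y) \<ominus>\<^bsub>F\<^esub> (r \<odot>\<^bsub>F\<^esub> g (x, y)) | r x y.
         r \<in> carrier K \<and> x \<in> carrier M \<and> y \<in> carrier N} \<union>
      {g (x, r \<odot>\<^bsub>N\<^esub> y) \<ominus>\<^bsub>F\<^esub> (r \<odot>\<^bsub>F\<^esub> g (x, y)) | r x y.
         r \<in> carrier K \<and> x \<in> carrier M \<and> y \<in> carrier N})"

definition tensor_null ::
  "'k ring \<Rightarrow> ('k, 'm) module \<Rightarrow> ('k, 'n) module \<Rightarrow> ('m \<times> 'n \<Rightarrow> 'k) set" where
  "tensor_null K M N =
     submodule_span K (free_module K (carrier M \<times> carrier N)) (tensor_rels K M N)"

definition tensor ::
  "'k ring \<Rightarrow> ('k, 'm) module \<Rightarrow> ('k, 'n) module \<Rightarrow> ('k, ('m \<times> 'n \<Rightarrow> 'k) set) module" where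
  "tensor K M N = quot_module (free_module K (carrier M \<times> carrier N)) (tensor_null K M N)"

text \<open>The elementary tensor \<open>m \<otimes> n\<close>.\<close>

definition tens ::
  "'k ring \<Rightarrow> ('k, 'm) module \<Rightarrow> ('k, 'n) module \<Rightarrow> 'm \<Rightarrow> 'n \<Rightarrow> ('m \<times> 'n \<Rightarrow> 'k) set" where
  "tens K M N m n = tensor_null K M N +>\<^bsub>free_module K (carrier M \<times> carrier N)\<^esub>
     free_gen K (carrier M \<times> carrier N) (m, n)"

text \<open>
  \<open>tensor_lift K M N P b\<close> is the linear map \<open>M \<otimes> N \<rightarrow> P\<close> with \<open>m \<otimes> n \<mapsto> b m n\<close> induced by a
  bilinear map \<open>b\<close>; the constant value on the coset is taken with \<open>the_elem\<close>, as for the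
  induced maps of HOL-Algebra.  It renders Sweedler notation: an
  expression \<open>b(x\<^sub>1, x\<^sub>2)\<close> with \<open>t = x\<^sub>1 \<otimes> x\<^sub>2\<close>, summation understood, is
  \<open>tensor_lift K M N P (\<lambda>x1 x2. b x1 x2) t\<close>.
\<close>

definition tensor_lift ::
  "'k ring \<Rightarrow> ('k, 'm) module \<Rightarrow> ('k, 'n) module \<Rightarrow> ('k, 'p) module \<Rightarrow> ('m \<Rightarrow> 'n \<Rightarrow> 'p)
     \<Rightarrow> ('m \<times> 'n \<Rightarrow> 'k) set \<Rightarrow> 'p" where
  "tensor_lift K M N P b t = the_elem
     ((\<lambda>F. \<Oplus>\<^bsub>P\<^esub> p \<in> {p \<in> carrier M \<times> carrier N. F p \<noteq> \<zero>\<^bsub>K\<^esub>}. F p \<odot>\<^bsub>P\<^esub> b (fst p) (snd p)) ` t)"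

definition tensor_map ::
  "'k ring \<Rightarrow> ('k, 'm) module \<Rightarrow> ('k, 'n) module \<Rightarrow> ('k, 'p) module \<Rightarrow> ('k, 'q) module
     \<Rightarrow> ('m \<Rightarrow> 'p) \<Rightarrow> ('n \<Rightarrow> 'q) \<Rightarrow> ('m \<times> 'n \<Rightarrow> 'k) set \<Rightarrow> ('p \<times> 'q \<Rightarrow> 'k) set" where
  "tensor_map K M N P Q f g =
     tensor_lift K M N (tensor K P Q) (\<lambda>m n. tens K P Q (f m) (g n))"


section \<open>Hom-algebras, Hom-coalgebras and Hom-entwining structures\<close>

locale hom_object = module K M
  for K :: "'k ring" and M :: "('k, 'm) module" and \<mu> :: "'m \<Rightarrow> 'm" +
  assumes aut_linear: "\<mu> \<in> linear_maps K M M"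
    and aut_bij: "bij_betw \<mu> (carrier M) (carrier M)"

abbreviation aut_inv :: "('k, 'm) module \<Rightarrow> ('m \<Rightarrow> 'm) \<Rightarrow> 'm \<Rightarrow> 'm" where
  "aut_inv M \<mu> \<equiv> inv_into (carrier M) \<mu>"

definition hom_morphisms :: "'k ring \<Rightarrow> ('k, 'm) module \<Rightarrow> ('m \<Rightarrow> 'm)
     \<Rightarrow> ('k, 'n) module \<Rightarrow> ('n \<Rightarrow> 'n) \<Rightarrow> ('m \<Rightarrow> 'n) set" where
  "hom_morphisms K M \<mu> N \<nu> = {f \<in> linear_maps K M N. \<forall>x\<in>carrier M. \<nu> (f x) = f (\<mu> x)}"

locale monoidal_hom_algebra = hom_object K A \<alpha>
  for K :: "'k ring" and A :: "('k, 'a) module" and \<alpha> :: "'a \<Rightarrow> 'a" +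
  assumes mult_bilinear: "mult A \<in> bilinear_maps K A A A"
    and one_closed: "\<one>\<^bsub>A\<^esub> \<in> carrier A"
    and hom_assoc: "\<And>a b c. \<lbrakk>a \<in> carrier A; b \<in> carrier A; c \<in> carrier A\<rbrakk>
          \<Longrightarrow> \<alpha> a \<otimes>\<^bsub>A\<^esub> (b \<otimes>\<^bsub>A\<^esub> c) = (a \<otimes>\<^bsub>A\<^esub> b) \<otimes>\<^bsub>A\<^esub> \<alpha> c"
    and hom_unit_right: "\<And>a. a \<in> carrier A \<Longrightarrow> a \<otimes>\<^bsub>A\<^esub> \<one>\<^bsub>A\<^esub> = \<alpha> a"
    and hom_unit_left: "\<And>a. a \<in> carrier A \<Longrightarrow> \<one>\<^bsub>A\<^esub> \<otimes>\<^bsub>A\<^esub> a = \<alpha> a"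
    and aut_mult: "\<And>a b. \<lbrakk>a \<in> carrier A; b \<in> carrier A\<rbrakk> \<Longrightarrow> \<alpha> (a \<otimes>\<^bsub>A\<^esub> b) = \<alpha> a \<otimes>\<^bsub>A\<^esub> \<alpha> b"
    and aut_one: "\<alpha> \<one>\<^bsub>A\<^esub> = \<one>\<^bsub>A\<^esub>"

text \<open>Hom-coassociativity is stated in \<open>C \<otimes> (C \<otimes> C)\<close>.\<close>

locale monoidal_hom_coalgebra = hom_object K C \<gamma>
  for K :: "'k ring" and C :: "('k, 'c) module" and \<gamma> :: "'c \<Rightarrow> 'c" +
  fixes \<Delta> :: "'c \<Rightarrow> ('c \<times> 'c \<Rightarrow> 'k) set" and \<epsilon> :: "'c \<Rightarrow> 'k"
  assumes comult_linear: "\<Delta> \<in> linear_maps K C (tensor K C C)"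
    and counit_linear: "\<epsilon> \<in> linear_maps K C (ring_as_module K)"
    and hom_coassoc: "\<And>c. c \<in> carrier C \<Longrightarrow>
          tensor_lift K C C (tensor K C (tensor K C C))
            (\<lambda>c1 c2. tens K C (tensor K C C) (aut_inv C \<gamma> c1) (\<Delta> c2)) (\<Delta> c)
        = tensor_lift K C C (tensor K C (tensor K C C))
            (\<lambda>c1 c2. tensor_lift K C C (tensor K C (tensor K C C))
               (\<lambda>c11 c12. tens K C (tensor K C C) c11 (tens K C C c12 (aut_inv C \<gamma> c2)))
               (\<Delta> c1)) (\<Delta> c)"
    and hom_counit_left: "\<And>c. c \<in> carrier C \<Longrightarrow>
          tensor_lift K C C C (\<lambda>c1 c2. \<epsilon> c1 \<odot>\<^bsub>C\<^esub> c2) (\<Delta> c) = aut_inv C \<gamma> c"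
    and hom_counit_right: "\<And>c. c \<in> carrier C \<Longrightarrow>
          tensor_lift K C C C (\<lambda>c1 c2. \<epsilon> c2 \<odot>\<^bsub>C\<^esub> c1) (\<Delta> c) = aut_inv C \<gamma> c"
    and comult_aut: "\<And>c. c \<in> carrier C \<Longrightarrow> \<Delta> (\<gamma> c) = tensor_map K C C C C \<gamma> \<gamma> (\<Delta> c)"
    and counit_aut: "\<And>c. c \<in> carrier C \<Longrightarrow> \<epsilon> (\<gamma> c) = \<epsilon> c"

text \<open>
  \<open>entwine_comult\<close> is stated in \<open>A \<otimes> (C \<otimes> C)\<close>.  In \<open>c\<^sup>\<kappa>\<^sup>\<lambda>\<close> and \<open>a\<^sub>\<kappa>\<^sub>\<lambda>\<close> the entwining indexed by
  \<open>\<kappa>\<close> is applied first.  The bound names \<open>ak\<close>, \<open>ck\<close>, \<open>a'l\<close>, \<open>ckl\<close>, ... stand for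
  \<open>a\<^sub>\<kappa>\<close>, \<open>c\<^sup>\<kappa>\<close>, \<open>a'\<^sub>\<lambda>\<close>, \<open>c\<^sup>\<kappa>\<^sup>\<lambda>\<close>; in \<open>entwine_comult\<close>, \<open>b\<close> stands for \<open>\<alpha>\<^sup>-\<^sup>1(a)\<close>.
\<close>

locale hom_entwining =
  alg: monoidal_hom_algebra K A \<alpha> + coalg: monoidal_hom_coalgebra K C \<gamma> \<Delta> \<epsilon>
  for K :: "'k ring" and A :: "('k, 'a) module" and \<alpha> :: "'a \<Rightarrow> 'a"
    and C :: "('k, 'c) module" and \<gamma> :: "'c \<Rightarrow> 'c"
    and \<Delta> :: "'c \<Rightarrow> ('c \<times> 'c \<Rightarrow> 'k) set" and \<epsilon> :: "'c \<Rightarrow> 'k" +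
  fixes \<psi> :: "('c \<times> 'a \<Rightarrow> 'k) set \<Rightarrow> ('a \<times> 'c \<Rightarrow> 'k) set"
  assumes entwine_morphism: "\<psi> \<in> hom_morphisms K
            (tensor K C A) (tensor_map K C A C A \<gamma> \<alpha>)
            (tensor K A C) (tensor_map K A C A C \<alpha> \<gamma>)"
    and entwine_mult: "\<And>a a' c. \<lbrakk>a \<in> carrier A; a' \<in> carrier A; c \<in> carrier C\<rbrakk> \<Longrightarrow>
          \<psi> (tens K C A (\<gamma> c) (a \<otimes>\<^bsub>A\<^esub> a'))
        = tensor_lift K A C (tensor K A C)
            (\<lambda>ak ck. tensor_lift K A C (tensor K A C)
               (\<lambda>a'l ckl. tens K A C (ak \<otimes>\<^bsub>A\<^esub> a'l) (\<gamma> ckl))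
               (\<psi> (tens K C A ck a'))) (\<psi> (tens K C A c a))"
    and entwine_comult: "\<And>a c. \<lbrakk>a \<in> carrier A; c \<in> carrier C\<rbrakk> \<Longrightarrow>
          tensor_lift K A C (tensor K A (tensor K C C))
            (\<lambda>ak ck. tens K A (tensor K C C) (aut_inv A \<alpha> ak) (\<Delta> ck)) (\<psi> (tens K C A c a))
        = tensor_lift K C C (tensor K A (tensor K C C))
            (\<lambda>c1 c2. tensor_lift K A C (tensor K A (tensor K C C))
               (\<lambda>bk c2k. tensor_lift K A C (tensor K A (tensor K C C))
                  (\<lambda>bkl c1l. tens K A (tensor K C C) bkl (tens K C C c1l c2k))
                  (\<psi> (tens K C A c1 bk)))
               (\<psi> (tens K C A c2 (aut_inv A \<alpha> a)))) (\<Delta> c)"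
    and entwine_one: "\<And>c. c \<in> carrier C \<Longrightarrow> \<psi> (tens K C A c \<one>\<^bsub>A\<^esub>) = tens K A C \<one>\<^bsub>A\<^esub> c"
    and entwine_counit: "\<And>a c. \<lbrakk>a \<in> carrier A; c \<in> carrier C\<rbrakk> \<Longrightarrow>
          tensor_lift K A C A (\<lambda>ak ck. \<epsilon> ck \<odot>\<^bsub>A\<^esub> ak) (\<psi> (tens K C A c a)) = \<epsilon> c \<odot>\<^bsub>A\<^esub> a"


section \<open>The Koppinen smash\<close>

definition koppinen_smash ::
  "'k ring \<Rightarrow> ('k, 'a) module \<Rightarrow> ('a \<Rightarrow> 'a) \<Rightarrow> ('k, 'c) module \<Rightarrow> ('c \<Rightarrow> 'c)
     \<Rightarrow> ('c \<Rightarrow> ('c \<times> 'c \<Rightarrow> 'k) set) \<Rightarrow> ('c \<Rightarrow> 'k)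
     \<Rightarrow> (('c \<times> 'a \<Rightarrow> 'k) set \<Rightarrow> ('a \<times> 'c \<Rightarrow> 'k) set) \<Rightarrow> ('k, 'c \<Rightarrow> 'a) module" where
  "koppinen_smash K A \<alpha> C \<gamma> \<Delta> \<epsilon> \<psi> =
     \<lparr>carrier = hom_morphisms K C \<gamma> A \<alpha> \<inter> extensional (carrier C),
      mult = (\<lambda>f g. \<lambda>c\<in>carrier C. tensor_lift K C C A
         (\<lambda>c1 c2. tensor_lift K A C A (\<lambda>ak c1k. ak \<otimes>\<^bsub>A\<^esub> g c1k) (\<psi> (tens K C A c1 (f c2)))) (\<Delta> c)),
      one = (\<lambda>c\<in>carrier C. \<epsilon> c \<odot>\<^bsub>A\<^esub> \<one>\<^bsub>A\<^esub>),
      zero = (\<lambda>c\<in>carrier C. \<zero>\<^bsub>A\<^esub>),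
      add = (\<lambda>f g. \<lambda>c\<in>carrier C. f c \<oplus>\<^bsub>A\<^esub> g c),
      smult = (\<lambda>r f. \<lambda>c\<in>carrier C. r \<odot>\<^bsub>A\<^esub> f c)\<rparr>"


section \<open>The associated Hom-coring and its left dual\<close>

text \<open>
  \<open>M \<otimes>\<^sub>A N\<close> as a quotient of \<open>M \<otimes> N\<close>; \<open>ract m a\<close> and \<open>lact a n\<close> are the right action on \<open>M\<close> and
  the left action on \<open>N\<close>.
\<close>

definition tensor_over_null ::
  "'k ring \<Rightarrow> ('k, 'a) module \<Rightarrow> ('k, 'm) module \<Rightarrow> ('m \<Rightarrow> 'm) \<Rightarrow> ('m \<Rightarrow> 'a \<Rightarrow> 'm)
     \<Rightarrow> ('k, 'n) module \<Rightarrow> ('n \<Rightarrow> 'n) \<Rightarrow> ('a \<Rightarrow> 'n \<Rightarrow> 'n) \<Rightarrow> ('m \<times> 'n \<Rightarrow> 'k) set set" where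
  "tensor_over_null K A M \<mu> ract N \<nu> lact = submodule_span K (tensor K M N)
     {tens K M N (ract m a) n \<ominus>\<^bsub>tensor K M N\<^esub> tens K M N (\<mu> m) (lact a (aut_inv N \<nu> n)) | m a n.
        m \<in> carrier M \<and> a \<in> carrier A \<and> n \<in> carrier N}"

definition tensor_over ::
  "'k ring \<Rightarrow> ('k, 'a) module \<Rightarrow> ('k, 'm) module \<Rightarrow> ('m \<Rightarrow> 'm) \<Rightarrow> ('m \<Rightarrow> 'a \<Rightarrow> 'm)
     \<Rightarrow> ('k, 'n) module \<Rightarrow> ('n \<Rightarrow> 'n) \<Rightarrow> ('a \<Rightarrow> 'n \<Rightarrow> 'n) \<Rightarrow> ('k, ('m \<times> 'n \<Rightarrow> 'k) set set) module" where
  "tensor_over K A M \<mu> ract N \<nu> lact =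
     quot_module (tensor K M N) (tensor_over_null K A M \<mu> ract N \<nu> lact)"

definition tens_over ::
  "'k ring \<Rightarrow> ('k, 'a) module \<Rightarrow> ('k, 'm) module \<Rightarrow> ('m \<Rightarrow> 'm) \<Rightarrow> ('m \<Rightarrow> 'a \<Rightarrow> 'm)
     \<Rightarrow> ('k, 'n) module \<Rightarrow> ('n \<Rightarrow> 'n) \<Rightarrow> ('a \<Rightarrow> 'n \<Rightarrow> 'n) \<Rightarrow> 'm \<Rightarrow> 'n \<Rightarrow> ('m \<times> 'n \<Rightarrow> 'k) set set" where
  "tens_over K A M \<mu> ract N \<nu> lact m n =
     tensor_over_null K A M \<mu> ract N \<nu> lact +>\<^bsub>tensor K M N\<^esub> tens K M N m n"

text \<open>The map \<open>M \<otimes>\<^sub>A N \<rightarrow> P\<close> induced by an \<open>A\<close>-balanced bilinear map \<open>b\<close>.\<close>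

definition tensor_over_lift ::
  "'k ring \<Rightarrow> ('k, 'm) module \<Rightarrow> ('k, 'n) module \<Rightarrow> ('k, 'p) module \<Rightarrow> ('m \<Rightarrow> 'n \<Rightarrow> 'p)
     \<Rightarrow> ('m \<times> 'n \<Rightarrow> 'k) set set \<Rightarrow> 'p" where
  "tensor_over_lift K M N P b X = the_elem (tensor_lift K M N P b ` X)"

definition coring_aut ::
  "'k ring \<Rightarrow> ('k, 'a) module \<Rightarrow> ('a \<Rightarrow> 'a) \<Rightarrow> ('k, 'c) module \<Rightarrow> ('c \<Rightarrow> 'c)
     \<Rightarrow> ('a \<times> 'c \<Rightarrow> 'k) set \<Rightarrow> ('a \<times> 'c \<Rightarrow> 'k) set" where
  "coring_aut K A \<alpha> C \<gamma> = tensor_map K A C A C \<alpha> \<gamma>"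

definition coring_lact ::
  "'k ring \<Rightarrow> ('k, 'a) module \<Rightarrow> ('a \<Rightarrow> 'a) \<Rightarrow> ('k, 'c) module \<Rightarrow> ('c \<Rightarrow> 'c)
     \<Rightarrow> 'a \<Rightarrow> ('a \<times> 'c \<Rightarrow> 'k) set \<Rightarrow> ('a \<times> 'c \<Rightarrow> 'k) set" where
  "coring_lact K A \<alpha> C \<gamma> a = tensor_lift K A C (tensor K A C)
     (\<lambda>a' c. tens K A C (aut_inv A \<alpha> a \<otimes>\<^bsub>A\<^esub> a') (\<gamma> c))"

definition coring_ract ::
  "'k ring \<Rightarrow> ('k, 'a) module \<Rightarrow> ('a \<Rightarrow> 'a) \<Rightarrow> ('k, 'c) module \<Rightarrow> ('c \<Rightarrow> 'c)
     \<Rightarrow> (('c \<times> 'a \<Rightarrow> 'k) set \<Rightarrow> ('a \<times> 'c \<Rightarrow> 'k) set)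
     \<Rightarrow> ('a \<times> 'c \<Rightarrow> 'k) set \<Rightarrow> 'a \<Rightarrow> ('a \<times> 'c \<Rightarrow> 'k) set" where
  "coring_ract K A \<alpha> C \<gamma> \<psi> x a = tensor_lift K A C (tensor K A C)
     (\<lambda>a' c. tensor_lift K A C (tensor K A C)
        (\<lambda>bk ck. tens K A C (a' \<otimes>\<^bsub>A\<^esub> bk) (\<gamma> ck)) (\<psi> (tens K C A c (aut_inv A \<alpha> a)))) x"

text \<open>The \<open>A\<close>-tensor square \<open>\<C> \<otimes>\<^sub>A \<C>\<close> of \<open>\<C> = A \<otimes> C\<close> and its elementary tensors.\<close>

definition coring_square ::
  "'k ring \<Rightarrow> ('k, 'a) module \<Rightarrow> ('a \<Rightarrow> 'a) \<Rightarrow> ('k, 'c) module \<Rightarrow> ('c \<Rightarrow> 'c)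
     \<Rightarrow> (('c \<times> 'a \<Rightarrow> 'k) set \<Rightarrow> ('a \<times> 'c \<Rightarrow> 'k) set)
     \<Rightarrow> ('k, (('a \<times> 'c \<Rightarrow> 'k) set \<times> ('a \<times> 'c \<Rightarrow> 'k) set \<Rightarrow> 'k) set set) module" where
  "coring_square K A \<alpha> C \<gamma> \<psi> = tensor_over K A
     (tensor K A C) (coring_aut K A \<alpha> C \<gamma>) (coring_ract K A \<alpha> C \<gamma> \<psi>)
     (tensor K A C) (coring_aut K A \<alpha> C \<gamma>) (coring_lact K A \<alpha> C \<gamma>)"

definition coring_tens ::
  "'k ring \<Rightarrow> ('k, 'a) module \<Rightarrow> ('a \<Rightarrow> 'a) \<Rightarrow> ('k, 'c) module \<Rightarrow> ('c \<Rightarrow> 'c)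
     \<Rightarrow> (('c \<times> 'a \<Rightarrow> 'k) set \<Rightarrow> ('a \<times> 'c \<Rightarrow> 'k) set)
     \<Rightarrow> ('a \<times> 'c \<Rightarrow> 'k) set \<Rightarrow> ('a \<times> 'c \<Rightarrow> 'k) set
     \<Rightarrow> (('a \<times> 'c \<Rightarrow> 'k) set \<times> ('a \<times> 'c \<Rightarrow> 'k) set \<Rightarrow> 'k) set set" where
  "coring_tens K A \<alpha> C \<gamma> \<psi> = tens_over K A
     (tensor K A C) (coring_aut K A \<alpha> C \<gamma>) (coring_ract K A \<alpha> C \<gamma> \<psi>)
     (tensor K A C) (coring_aut K A \<alpha> C \<gamma>) (coring_lact K A \<alpha> C \<gamma>)"

definition coring_comult ::
  "'k ring \<Rightarrow> ('k, 'a) module \<Rightarrow> ('a \<Rightarrow> 'a) \<Rightarrow> ('k, 'c) module \<Rightarrow> ('c \<Rightarrow> 'c)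
     \<Rightarrow> ('c \<Rightarrow> ('c \<times> 'c \<Rightarrow> 'k) set) \<Rightarrow> (('c \<times> 'a \<Rightarrow> 'k) set \<Rightarrow> ('a \<times> 'c \<Rightarrow> 'k) set)
     \<Rightarrow> ('a \<times> 'c \<Rightarrow> 'k) set
     \<Rightarrow> (('a \<times> 'c \<Rightarrow> 'k) set \<times> ('a \<times> 'c \<Rightarrow> 'k) set \<Rightarrow> 'k) set set" where
  "coring_comult K A \<alpha> C \<gamma> \<Delta> \<psi> = tensor_lift K A C (coring_square K A \<alpha> C \<gamma> \<psi>)
     (\<lambda>a c. tensor_lift K C C (coring_square K A \<alpha> C \<gamma> \<psi>)
        (\<lambda>c1 c2. coring_tens K A \<alpha> C \<gamma> \<psi>
           (tens K A C (aut_inv A \<alpha> a) c1) (tens K A C \<one>\<^bsub>A\<^esub> c2)) (\<Delta> c))"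

definition coring_counit ::
  "'k ring \<Rightarrow> ('k, 'a) module \<Rightarrow> ('a \<Rightarrow> 'a) \<Rightarrow> ('k, 'c) module \<Rightarrow> ('c \<Rightarrow> 'k)
     \<Rightarrow> ('a \<times> 'c \<Rightarrow> 'k) set \<Rightarrow> 'a" where
  "coring_counit K A \<alpha> C \<epsilon> = tensor_lift K A C A (\<lambda>a c. \<epsilon> c \<odot>\<^bsub>A\<^esub> \<alpha> a)"

definition left_dual_algebra ::
  "'k ring \<Rightarrow> ('k, 'a) module \<Rightarrow> ('a \<Rightarrow> 'a) \<Rightarrow> ('k, 'c) module \<Rightarrow> ('c \<Rightarrow> 'c)
     \<Rightarrow> ('c \<Rightarrow> ('c \<times> 'c \<Rightarrow> 'k) set) \<Rightarrow> ('c \<Rightarrow> 'k)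
     \<Rightarrow> (('c \<times> 'a \<Rightarrow> 'k) set \<Rightarrow> ('a \<times> 'c \<Rightarrow> 'k) set)
     \<Rightarrow> ('k, ('a \<times> 'c \<Rightarrow> 'k) set \<Rightarrow> 'a) module" where
  "left_dual_algebra K A \<alpha> C \<gamma> \<Delta> \<epsilon> \<psi> =
     \<lparr>carrier = {\<xi> \<in> hom_morphisms K (tensor K A C) (coring_aut K A \<alpha> C \<gamma>) A \<alpha>
                     \<inter> extensional (carrier (tensor K A C)).
         \<forall>a\<in>carrier A. \<forall>x\<in>carrier (tensor K A C). \<xi> (coring_lact K A \<alpha> C \<gamma> a x) = a \<otimes>\<^bsub>A\<^esub> \<xi> x},
      mult = (\<lambda>\<xi> \<xi>'. \<lambda>x\<in>carrier (tensor K A C).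
         tensor_over_lift K (tensor K A C) (tensor K A C) A
           (\<lambda>x1 x2. \<xi> (coring_ract K A \<alpha> C \<gamma> \<psi> x1 (\<xi>' x2))) (coring_comult K A \<alpha> C \<gamma> \<Delta> \<psi> x)),
      one = restrict (coring_counit K A \<alpha> C \<epsilon>) (carrier (tensor K A C)),
      zero = (\<lambda>x\<in>carrier (tensor K A C). \<zero>\<^bsub>A\<^esub>),
      add = (\<lambda>\<xi> \<xi>'. \<lambda>x\<in>carrier (tensor K A C). \<xi> x \<oplus>\<^bsub>A\<^esub> \<xi>' x),
      smult = (\<lambda>r \<xi>. \<lambda>x\<in>carrier (tensor K A C). r \<odot>\<^bsub>A\<^esub> \<xi> x)\<rparr>"


section \<open>Associative unital algebras and anti-isomorphisms\<close>

text \<open>The locale \<open>algebra\<close> of HOL-Algebra is not used, since it requires commutativity.\<close>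

definition assoc_unital_algebra :: "'k ring \<Rightarrow> ('k, 'b) module \<Rightarrow> bool" where
  "assoc_unital_algebra K B \<longleftrightarrow> module K B \<and> ring B \<and> mult B \<in> bilinear_maps K B B B"

definition algebra_anti_iso ::
  "'k ring \<Rightarrow> ('k, 'b) module \<Rightarrow> ('k, 'd) module \<Rightarrow> ('b \<Rightarrow> 'd) set" where
  "algebra_anti_iso K B D = {\<Phi> \<in> linear_maps K B D.
     bij_betw \<Phi> (carrier B) (carrier D) \<and> \<Phi> \<one>\<^bsub>B\<^esub> = \<one>\<^bsub>D\<^esub> \<and>
     (\<forall>x\<in>carrier B. \<forall>y\<in>carrier B. \<Phi> (x \<otimes>\<^bsub>B\<^esub> y) = \<Phi> y \<otimes>\<^bsub>D\<^esub> \<Phi> x)}"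

end

theory Submission
  imports Defs
begin

text \<open>
  A left \<open>A\<close>-linear map \<open>\<xi>\<close> on the coring \<open>A \<otimes> C\<close> is determined by its values \<open>\<xi>(1 \<otimes> c)\<close>, because
  \<open>a (1 \<otimes> c) = a \<otimes> \<gamma>(c)\<close>.  The anti-isomorphism is the resulting extension of \<open>f : C \<rightarrow> A\<close> to
  \<open>a \<otimes> c \<mapsto> a f(c)\<close> (\<open>extend\<close> below).  As \<open>1 f(c) = \<alpha>(f(c))\<close>, its inverse is
  \<open>\<xi> \<mapsto> (c \<mapsto> \<alpha>\<^sup>-\<^sup>1(\<xi>(1 \<otimes> c)))\<close>, and not restriction to \<open>1 \<otimes> C\<close>.  It is this twist by \<open>\<alpha>\<close> that makes
  products match: with \<open>\<xi>\<^sub>f\<close> the extension of \<open>f\<close>,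
  \<open>(\<xi>\<^sub>g *\<^sup>l \<xi>\<^sub>f)(a \<otimes> c) = (\<alpha>\<^sup>-\<^sup>1(a) f(c\<^sub>2)\<^sub>\<kappa>) g(\<gamma>(c\<^sub>1\<^sup>\<kappa>)) = a (f(c\<^sub>2)\<^sub>\<kappa> g(c\<^sub>1\<^sup>\<kappa>))\<close>
  by Hom-associativity and \<open>g \<circ> \<gamma> = \<alpha> \<circ> g\<close>, which is the extension of \<open>f *\<^sub>\<psi> g\<close> (\<open>extend_mult\<close>).

  The product \<open>*\<^sub>\<psi>\<close> is associative (\<open>koppinen_assoc\<close>) because both bracketings evaluate one
  trilinear expression \<open>G\<close>: compatibility of \<open>\<psi>\<close> with the product of \<open>A\<close> turns \<open>(f * g) * h\<close> into
  \<open>G(\<gamma>\<^sup>-\<^sup>1(c\<^sub>1), c\<^sub>2\<^sub>1, c\<^sub>2\<^sub>2)\<close>, compatibility with the coproduct of \<open>C\<close> turns \<open>f * (g * h)\<close> into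
  \<open>G(c\<^sub>1\<^sub>1, c\<^sub>1\<^sub>2, \<gamma>\<^sup>-\<^sup>1(c\<^sub>2))\<close>, and Hom-coassociativity equates the two.  The algebra axioms of the left dual
  then follow by transport along the bijection (\<open>assoc_unital_algebra_anti_transport\<close>).  That \<open>*\<^sup>l\<close> can
  be computed on representatives in \<open>\<C> \<otimes> \<C>\<close>, where \<open>\<C> = A \<otimes> C\<close>, holds because
  \<open>\<xi>(x\<^sub>1 \<xi>'(x\<^sub>2))\<close> is \<open>A\<close>-balanced (\<open>dual_product_balanced\<close>).

  Sweedler notation denotes linear maps out of tensor products.  Computing with it rests on the
  universal property of the tensor product (\<open>tensor_lift_linear\<close>, \<open>tensor_lift_tens\<close>,
  \<open>tensor_linear_eqI\<close>) and on \<open>linear_tensor_lift_cong\<close>, which moves a linear map under the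
  summation sign and rewrites the summand there.  The section on Sweedler calculus restates the
  axioms in the form "for every bilinear or trilinear \<open>b\<close>", in which they can be used as rewriting
  steps inside a summation.
\<close>


section \<open>Linear maps and quotient modules\<close>

lemma linear_mapsI:
  assumes "\<And>x. x \<in> carrier M \<Longrightarrow> f x \<in> carrier N"
    and "\<And>x y. \<lbrakk>x \<in> carrier M; y \<in> carrier M\<rbrakk> \<Longrightarrow> f (x \<oplus>\<^bsub>M\<^esub> y) = f x \<oplus>\<^bsub>N\<^esub> f y"
    and "\<And>r x. \<lbrakk>r \<in> carrier K; x \<in> carrier M\<rbrakk> \<Longrightarrow> f (r \<odot>\<^bsub>M\<^esub> x) = r \<odot>\<^bsub>N\<^esub> f x"
  shows "f \<in> linear_maps K M N"
  using assms unfolding linear_maps_def by auto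

lemma linear_closed: "\<lbrakk>f \<in> linear_maps K M N; x \<in> carrier M\<rbrakk> \<Longrightarrow> f x \<in> carrier N"
  and linear_add: "\<lbrakk>f \<in> linear_maps K M N; x \<in> carrier M; y \<in> carrier M\<rbrakk>
    \<Longrightarrow> f (x \<oplus>\<^bsub>M\<^esub> y) = f x \<oplus>\<^bsub>N\<^esub> f y"
  and linear_smult: "\<lbrakk>f \<in> linear_maps K M N; r \<in> carrier K; x \<in> carrier M\<rbrakk>
    \<Longrightarrow> f (r \<odot>\<^bsub>M\<^esub> x) = r \<odot>\<^bsub>N\<^esub> f x"
  unfolding linear_maps_def by auto

lemma linear_zero:
  assumes "module K M" "module K N" "f \<in> linear_maps K M N"
  shows "f \<zero>\<^bsub>M\<^esub> = \<zero>\<^bsub>N\<^esub>"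
proof -
  interpret M: module K M by fact
  interpret N: module K N by fact
  have "f (\<zero>\<^bsub>K\<^esub> \<odot>\<^bsub>M\<^esub> \<zero>\<^bsub>M\<^esub>) = \<zero>\<^bsub>K\<^esub> \<odot>\<^bsub>N\<^esub> f \<zero>\<^bsub>M\<^esub>"
    by (rule linear_smult[OF assms(3)]) auto
  then show ?thesis
    by (simp add: linear_closed[OF assms(3)])
qed

lemma module_minus_eq:
  assumes "module K M" "x \<in> carrier M" "y \<in> carrier M"
  shows "x \<ominus>\<^bsub>M\<^esub> y = x \<oplus>\<^bsub>M\<^esub> (\<ominus>\<^bsub>K\<^esub> \<one>\<^bsub>K\<^esub>) \<odot>\<^bsub>M\<^esub> y"
proof -
  interpret M: module K M by fact
  show ?thesis using assms by (simp add: a_minus_def M.smult_l_minus)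
qed

lemma linear_diff:
  assumes "module K M" "module K N" "f \<in> linear_maps K M N" "x \<in> carrier M" "y \<in> carrier M"
  shows "f (x \<ominus>\<^bsub>M\<^esub> y) = f x \<ominus>\<^bsub>N\<^esub> f y"
proof -
  interpret M: module K M by fact
  interpret N: module K N by fact
  show ?thesis
    using assms linear_closed[OF assms(3)]
    by (simp add: module_minus_eq[of K] linear_add[OF assms(3)] linear_smult[OF assms(3)])
qed

lemma bilinear_mapsI:
  assumes "\<And>x. x \<in> carrier M \<Longrightarrow> (\<lambda>y. b x y) \<in> linear_maps K N P"
    and "\<And>y. y \<in> carrier N \<Longrightarrow> (\<lambda>x. b x y) \<in> linear_maps K M P"
  shows "(\<lambda>x y. b x y) \<in> bilinear_maps K M N P"
  using assms unfolding bilinear_maps_def by auto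

lemma bilinear_left: "\<lbrakk>b \<in> bilinear_maps K M N P; y \<in> carrier N\<rbrakk>
    \<Longrightarrow> (\<lambda>x. b x y) \<in> linear_maps K M P"
  and bilinear_right: "\<lbrakk>b \<in> bilinear_maps K M N P; x \<in> carrier M\<rbrakk>
    \<Longrightarrow> (\<lambda>y. b x y) \<in> linear_maps K N P"
  unfolding bilinear_maps_def by auto

lemma bilinear_closed: "\<lbrakk>b \<in> bilinear_maps K M N P; x \<in> carrier M; y \<in> carrier N\<rbrakk>
    \<Longrightarrow> b x y \<in> carrier P"
  using linear_closed[OF bilinear_left] .

lemma linear_kernel_submodule:
  assumes "module K M" "module K N" "f \<in> linear_maps K M N"
  shows "submodule {x \<in> carrier M. f x = \<zero>\<^bsub>N\<^esub>} K M"
proof -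
  interpret M: module K M by fact
  interpret N: module K N by fact
  have neg: "f (\<ominus>\<^bsub>M\<^esub> x) = \<zero>\<^bsub>N\<^esub>" if "x \<in> carrier M" "f x = \<zero>\<^bsub>N\<^esub>" for x
    using linear_diff[OF assms, of "\<zero>\<^bsub>M\<^esub>" x] that linear_zero[OF assms]
    by (simp add: a_minus_def)
  show ?thesis
    by (rule M.submoduleI)
      (use linear_zero[OF assms] linear_add[OF assms(3)] linear_smult[OF assms(3)] neg in auto)
qed

lemma submodule_span_superset: "S \<subseteq> submodule_span K M S"
  unfolding submodule_span_def by auto

lemma submodule_span_least: "\<lbrakk>submodule H K M; S \<subseteq> H\<rbrakk> \<Longrightarrow> submodule_span K M S \<subseteq> H"
  unfolding submodule_span_def by auto

lemma submodule_span_submodule: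
  assumes "module K M" "S \<subseteq> carrier M"
  shows "submodule (submodule_span K M S) K M"
proof -
  interpret M: module K M by fact
  have top: "submodule (carrier M) K M"
    by (rule M.submoduleI) auto
  have H: "\<zero>\<^bsub>M\<^esub> \<in> H" "\<And>a. a \<in> H \<Longrightarrow> \<ominus>\<^bsub>M\<^esub> a \<in> H"
    "\<And>a b. \<lbrakk>a \<in> H; b \<in> H\<rbrakk> \<Longrightarrow> a \<oplus>\<^bsub>M\<^esub> b \<in> H"
    "\<And>r a. \<lbrakk>r \<in> carrier K; a \<in> H\<rbrakk> \<Longrightarrow> r \<odot>\<^bsub>M\<^esub> a \<in> H" if "submodule H K M" for H
    using M.submoduleE[OF that] subgroup.one_closed[OF submodule.axioms(1)[OF that]] by auto
  show ?thesis
    unfolding submodule_span_def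
    by (rule M.submoduleI) (use top assms(2) H in auto)
qed

text \<open>A linear map that kills the generators of a span kills the whole span, since its kernel is
  a submodule.\<close>

lemma linear_zero_on_span:
  assumes "module K M" "module K N" "f \<in> linear_maps K M N" "S \<subseteq> carrier M"
    and "\<And>s. s \<in> S \<Longrightarrow> f s = \<zero>\<^bsub>N\<^esub>" and "x \<in> submodule_span K M S"
  shows "f x = \<zero>\<^bsub>N\<^esub>"
  using submodule_span_least[OF linear_kernel_submodule[OF assms(1-3)], of S] assms(4-6) by auto

lemma submodule_abelian_subgroup:
  assumes "module K M" "submodule N K M"
  shows "abelian_subgroup N M"
  by (rule abelian_subgroupI2[OF abelian_group.a_comm_group[OF module.axioms(2)[OF assms(1)]]
        submodule.axioms(1)[OF assms(2)]])

text \<open>A locale rather than a hypothesis in each lemma, because the tensor product over \<open>K\<close> and the one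
  over a Hom-algebra are both quotients of this kind.\<close>

locale quotient_module =
  fixes K :: "'k ring" and M :: "('k, 'm) module" and N :: "'m set"
  assumes mod: "module K M" and sub: "submodule N K M"
begin

sublocale M: module K M by (rule mod)
sublocale N: abelian_subgroup N M by (rule submodule_abelian_subgroup[OF mod sub])

lemma coset_in_carrier: "x \<in> carrier M \<Longrightarrow> N +>\<^bsub>M\<^esub> x \<in> carrier (quot_module M N)"
  by (auto simp: quot_module_def A_RCOSETS_def')

lemma carrierE:
  assumes "X \<in> carrier (quot_module M N)"
  obtains x where "x \<in> carrier M" "X = N +>\<^bsub>M\<^esub> x"
  using assms by (auto simp: quot_module_def A_RCOSETS_def')

lemma coset_add: "\<lbrakk>x \<in> carrier M; y \<in> carrier M\<rbrakk>
    \<Longrightarrow> (N +>\<^bsub>M\<^esub> x) \<oplus>\<^bsub>quot_module M N\<^esub> (N +>\<^bsub>M\<^esub> y) = N +>\<^bsub>M\<^esub> (x \<oplus>\<^bsub>M\<^esub> y)"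
  by (simp add: quot_module_def N.a_rcos_sum)

lemma coset_memE:
  assumes "y \<in> N +>\<^bsub>M\<^esub> x"
  obtains n where "n \<in> N" "y = n \<oplus>\<^bsub>M\<^esub> x"
  using assms by (auto simp: a_r_coset_def')

lemma coset_absorb:
  assumes "x \<in> carrier M" "n \<in> N"
  shows "N +>\<^bsub>M\<^esub> (n \<oplus>\<^bsub>M\<^esub> x) = N +>\<^bsub>M\<^esub> x"
proof -
  have "n \<oplus>\<^bsub>M\<^esub> x \<in> N +>\<^bsub>M\<^esub> x"
    using assms(2) by (auto simp: a_r_coset_def')
  then show ?thesis
    using M.a_repr_independence[of "n \<oplus>\<^bsub>M\<^esub> x" N x] assms(1) N.a_subgroup by auto
qed

lemma coset_smult:
  assumes "r \<in> carrier K" "x \<in> carrier M"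
  shows "r \<odot>\<^bsub>quot_module M N\<^esub> (N +>\<^bsub>M\<^esub> x) = N +>\<^bsub>M\<^esub> (r \<odot>\<^bsub>M\<^esub> x)"
proof -
  have "N +>\<^bsub>M\<^esub> (r \<odot>\<^bsub>M\<^esub> y) = N +>\<^bsub>M\<^esub> (r \<odot>\<^bsub>M\<^esub> x)" if y: "y \<in> N +>\<^bsub>M\<^esub> x" for y
  proof -
    from y obtain n where n: "n \<in> N" "y = n \<oplus>\<^bsub>M\<^esub> x" by (rule coset_memE)
    have "r \<odot>\<^bsub>M\<^esub> y = r \<odot>\<^bsub>M\<^esub> n \<oplus>\<^bsub>M\<^esub> r \<odot>\<^bsub>M\<^esub> x"
      using n assms N.a_Hcarr by (simp add: M.smult_r_distr)
    then show ?thesis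
      using coset_absorb[of "r \<odot>\<^bsub>M\<^esub> x" "r \<odot>\<^bsub>M\<^esub> n"] assms n
        submodule.smult_closed[OF sub] by simp
  qed
  moreover have "N +>\<^bsub>M\<^esub> x \<noteq> {}"
    using N.a_rcos_self[OF assms(2)] by blast
  ultimately have "(\<Union>y\<in>N +>\<^bsub>M\<^esub> x. N +>\<^bsub>M\<^esub> (r \<odot>\<^bsub>M\<^esub> y)) = N +>\<^bsub>M\<^esub> (r \<odot>\<^bsub>M\<^esub> x)"
    by (intro SUP_eq_const)
  then show ?thesis
    unfolding quot_module_def by simp
qed

lemma coset_zero: "\<zero>\<^bsub>quot_module M N\<^esub> = N +>\<^bsub>M\<^esub> \<zero>\<^bsub>M\<^esub>"
  by (simp add: quot_module_def M.a_coset_add_zero N.a_subset)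

lemma quot_module: "module K (quot_module M N)"
proof (rule moduleI)
  let ?Q = "quot_module M N"
  note simps = coset_add coset_smult coset_zero coset_in_carrier
  show "cring K" by (rule module.axioms(1)[OF mod])
  show "abelian_group ?Q"
  proof (rule abelian_groupI)
    show "\<zero>\<^bsub>?Q\<^esub> \<in> carrier ?Q"
      using coset_in_carrier[OF M.zero_closed] by (simp only: coset_zero)
  next
    fix X assume "X \<in> carrier ?Q"
    then obtain x where x: "x \<in> carrier M" "X = N +>\<^bsub>M\<^esub> x" by (rule carrierE)
    then show "\<zero>\<^bsub>?Q\<^esub> \<oplus>\<^bsub>?Q\<^esub> X = X"
      by (simp add: simps del: M.a_coset_add_zero)
    from x have "(N +>\<^bsub>M\<^esub> \<ominus>\<^bsub>M\<^esub> x) \<oplus>\<^bsub>?Q\<^esub> X = \<zero>\<^bsub>?Q\<^esub>"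
      by (simp add: coset_add coset_zero M.l_neg)
    with x show "\<exists>Y\<in>carrier ?Q. Y \<oplus>\<^bsub>?Q\<^esub> X = \<zero>\<^bsub>?Q\<^esub>"
      by (meson M.a_inv_closed coset_in_carrier)
  next
    fix X Y assume "X \<in> carrier ?Q" "Y \<in> carrier ?Q"
    then obtain x y where "x \<in> carrier M" "y \<in> carrier M" "X = N +>\<^bsub>M\<^esub> x" "Y = N +>\<^bsub>M\<^esub> y"
      by (metis carrierE)
    then show "X \<oplus>\<^bsub>?Q\<^esub> Y \<in> carrier ?Q" "X \<oplus>\<^bsub>?Q\<^esub> Y = Y \<oplus>\<^bsub>?Q\<^esub> X"
      by (simp_all add: simps M.a_comm)
  next
    fix X Y Z assume "X \<in> carrier ?Q" "Y \<in> carrier ?Q" "Z \<in> carrier ?Q"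
    then obtain x y z where "x \<in> carrier M" "y \<in> carrier M" "z \<in> carrier M"
      "X = N +>\<^bsub>M\<^esub> x" "Y = N +>\<^bsub>M\<^esub> y" "Z = N +>\<^bsub>M\<^esub> z"
      by (metis carrierE)
    then show "X \<oplus>\<^bsub>?Q\<^esub> Y \<oplus>\<^bsub>?Q\<^esub> Z = X \<oplus>\<^bsub>?Q\<^esub> (Y \<oplus>\<^bsub>?Q\<^esub> Z)"
      by (simp add: simps M.a_assoc)
  qed
  fix X assume "X \<in> carrier ?Q"
  then obtain x where x: "x \<in> carrier M" "X = N +>\<^bsub>M\<^esub> x" by (rule carrierE)
  then show "\<one>\<^bsub>K\<^esub> \<odot>\<^bsub>?Q\<^esub> X = X"
    by (simp add: simps)
  fix r assume r: "r \<in> carrier K"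
  with x show "r \<odot>\<^bsub>?Q\<^esub> X \<in> carrier ?Q"
    by (simp add: simps)
  { fix q assume "q \<in> carrier K"
    with r x show "(r \<oplus>\<^bsub>K\<^esub> q) \<odot>\<^bsub>?Q\<^esub> X = r \<odot>\<^bsub>?Q\<^esub> X \<oplus>\<^bsub>?Q\<^esub> q \<odot>\<^bsub>?Q\<^esub> X"
      and "(r \<otimes>\<^bsub>K\<^esub> q) \<odot>\<^bsub>?Q\<^esub> X = r \<odot>\<^bsub>?Q\<^esub> (q \<odot>\<^bsub>?Q\<^esub> X)"
      by (simp_all add: simps M.smult_l_distr M.smult_assoc1) }
  fix Y assume "Y \<in> carrier ?Q"
  then obtain y where "y \<in> carrier M" "Y = N +>\<^bsub>M\<^esub> y" by (rule carrierE)
  with r x show "r \<odot>\<^bsub>?Q\<^esub> (X \<oplus>\<^bsub>?Q\<^esub> Y) = r \<odot>\<^bsub>?Q\<^esub> X \<oplus>\<^bsub>?Q\<^esub> r \<odot>\<^bsub>?Q\<^esub> Y"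
    by (simp add: simps M.smult_r_distr)
qed

lemma coset_linear: "(\<lambda>x. N +>\<^bsub>M\<^esub> x) \<in> linear_maps K M (quot_module M N)"
  by (rule linear_mapsI) (auto simp: coset_in_carrier coset_add coset_smult)

lemma coset_eqI:
  assumes "x \<in> carrier M" "y \<in> carrier M" "x \<ominus>\<^bsub>M\<^esub> y \<in> N"
  shows "N +>\<^bsub>M\<^esub> x = N +>\<^bsub>M\<^esub> y"
proof -
  have "(x \<ominus>\<^bsub>M\<^esub> y) \<oplus>\<^bsub>M\<^esub> y = x"
    using assms by (simp add: a_minus_def M.a_assoc M.l_neg)
  then show ?thesis using coset_absorb[OF assms(2,3)] by simp
qed

text \<open>\<open>f\<close> is constant on a coset of \<open>N\<close>, so \<open>the_elem\<close> picks its value at any representative.\<close>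

lemma lift_coset:
  assumes "module K P" "f \<in> linear_maps K M P" "\<And>n. n \<in> N \<Longrightarrow> f n = \<zero>\<^bsub>P\<^esub>" "x \<in> carrier M"
  shows "the_elem (f ` (N +>\<^bsub>M\<^esub> x)) = f x"
proof -
  interpret P: module K P by fact
  have "f y = f x" if y: "y \<in> N +>\<^bsub>M\<^esub> x" for y
  proof -
    from y obtain n where n: "n \<in> N" "y = n \<oplus>\<^bsub>M\<^esub> x" by (rule coset_memE)
    have "f y = f n \<oplus>\<^bsub>P\<^esub> f x"
      unfolding n(2) by (rule linear_add[OF assms(2) N.a_Hcarr[OF n(1)] assms(4)])
    then show ?thesis
      by (simp add: assms(3)[OF n(1)] linear_closed[OF assms(2,4)])
  qed
  moreover have "N +>\<^bsub>M\<^esub> x \<noteq> {}"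
    using N.a_rcos_self[OF assms(4)] by blast
  ultimately show ?thesis
    by (intro the_elem_image_unique)
qed

lemma lift_linear:
  assumes "module K P" "f \<in> linear_maps K M P" "\<And>n. n \<in> N \<Longrightarrow> f n = \<zero>\<^bsub>P\<^esub>"
  shows "(\<lambda>X. the_elem (f ` X)) \<in> linear_maps K (quot_module M N) P"
proof (rule linear_mapsI)
  have lift: "the_elem (f ` (N +>\<^bsub>M\<^esub> x)) = f x" if "x \<in> carrier M" for x
    using lift_coset[OF assms(1,2) _ that] assms(3) by blast
  fix X assume "X \<in> carrier (quot_module M N)"
  then obtain x where x: "x \<in> carrier M" "X = N +>\<^bsub>M\<^esub> x" by (rule carrierE)
  show "the_elem (f ` X) \<in> carrier P"
    unfolding x(2) lift[OF x(1)] by (rule linear_closed[OF assms(2) x(1)])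
  { fix r assume r: "r \<in> carrier K"
    show "the_elem (f ` (r \<odot>\<^bsub>quot_module M N\<^esub> X)) = r \<odot>\<^bsub>P\<^esub> the_elem (f ` X)"
      unfolding x(2) coset_smult[OF r x(1)] lift[OF x(1)] lift[OF M.smult_closed[OF r x(1)]]
      by (rule linear_smult[OF assms(2) r x(1)]) }
  fix Y assume "Y \<in> carrier (quot_module M N)"
  then obtain y where y: "y \<in> carrier M" "Y = N +>\<^bsub>M\<^esub> y" by (rule carrierE)
  show "the_elem (f ` (X \<oplus>\<^bsub>quot_module M N\<^esub> Y)) = the_elem (f ` X) \<oplus>\<^bsub>P\<^esub> the_elem (f ` Y)"
    unfolding x(2) y(2) coset_add[OF x(1) y(1)] lift[OF x(1)] lift[OF y(1)]
      lift[OF M.add.m_closed[OF x(1) y(1)]]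
    by (rule linear_add[OF assms(2) x(1) y(1)])
qed

end


section \<open>Free modules\<close>

lemma free_module_carrier_iff: "F \<in> carrier (free_module K S) \<longleftrightarrow>
    F \<in> S \<rightarrow>\<^sub>E carrier K \<and> finite {s \<in> S. F s \<noteq> \<zero>\<^bsub>K\<^esub>}"
  by (simp add: free_module_def)

lemma free_module_eqI:
  assumes "F \<in> carrier (free_module K S)" "G \<in> carrier (free_module K S)"
    and "\<And>s. s \<in> S \<Longrightarrow> F s = G s"
  shows "F = G"
  using assms unfolding free_module_carrier_iff by (auto intro: PiE_ext)

lemma free_module_apply: "\<lbrakk>F \<in> carrier (free_module K S); s \<in> S\<rbrakk> \<Longrightarrow> F s \<in> carrier K"
  unfolding free_module_carrier_iff by auto

lemma free_module_ops:
  assumes "s \<in> S"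
  shows "(F \<oplus>\<^bsub>free_module K S\<^esub> G) s = F s \<oplus>\<^bsub>K\<^esub> G s"
    and "(r \<odot>\<^bsub>free_module K S\<^esub> F) s = r \<otimes>\<^bsub>K\<^esub> F s"
    and "\<zero>\<^bsub>free_module K S\<^esub> s = \<zero>\<^bsub>K\<^esub>"
  using assms by (auto simp: free_module_def)

lemma free_module_closed:
  assumes "cring K"
  shows "\<lbrakk>F \<in> carrier (free_module K S); G \<in> carrier (free_module K S)\<rbrakk>
      \<Longrightarrow> F \<oplus>\<^bsub>free_module K S\<^esub> G \<in> carrier (free_module K S)"
    and "\<lbrakk>r \<in> carrier K; F \<in> carrier (free_module K S)\<rbrakk>
      \<Longrightarrow> r \<odot>\<^bsub>free_module K S\<^esub> F \<in> carrier (free_module K S)"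
    and "\<zero>\<^bsub>free_module K S\<^esub> \<in> carrier (free_module K S)"
    and "s \<in> S \<Longrightarrow> free_gen K S s \<in> carrier (free_module K S)"
proof -
  interpret K: cring K by fact
  { assume F: "F \<in> carrier (free_module K S)" and G: "G \<in> carrier (free_module K S)"
    then have "{s \<in> S. (\<lambda>s\<in>S. F s \<oplus>\<^bsub>K\<^esub> G s) s \<noteq> \<zero>\<^bsub>K\<^esub>}
        \<subseteq> {s \<in> S. F s \<noteq> \<zero>\<^bsub>K\<^esub>} \<union> {s \<in> S. G s \<noteq> \<zero>\<^bsub>K\<^esub>}" by auto
    from finite_subset[OF this] F G
    show "F \<oplus>\<^bsub>free_module K S\<^esub> G \<in> carrier (free_module K S)"
      by (auto simp: free_module_def) }
  { assume r: "r \<in> carrier K" and F: "F \<in> carrier (free_module K S)"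
    then have "{s \<in> S. (\<lambda>s\<in>S. r \<otimes>\<^bsub>K\<^esub> F s) s \<noteq> \<zero>\<^bsub>K\<^esub>} \<subseteq> {s \<in> S. F s \<noteq> \<zero>\<^bsub>K\<^esub>}" by auto
    from finite_subset[OF this] r F
    show "r \<odot>\<^bsub>free_module K S\<^esub> F \<in> carrier (free_module K S)"
      by (auto simp: free_module_def) }
  show "\<zero>\<^bsub>free_module K S\<^esub> \<in> carrier (free_module K S)"
    by (auto simp: free_module_def)
  assume "s \<in> S"
  have "{t \<in> S. free_gen K S s t \<noteq> \<zero>\<^bsub>K\<^esub>} \<subseteq> {s}"
    by (auto simp: free_gen_def)
  from finite_subset[OF this] show "free_gen K S s \<in> carrier (free_module K S)"
    by (auto simp: free_module_carrier_iff free_gen_def)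
qed

lemma free_module_module:
  assumes "cring K"
  shows "module K (free_module K S)"
proof -
  interpret K: cring K by fact
  note cl = free_module_closed[OF assms]
  note [simp] = free_module_apply free_module_ops cl
  show ?thesis
  proof (rule moduleI)
    show "abelian_group (free_module K S)"
    proof (rule abelian_groupI)
      fix F assume F: "F \<in> carrier (free_module K S)"
      have "((\<ominus>\<^bsub>K\<^esub> \<one>\<^bsub>K\<^esub>) \<odot>\<^bsub>free_module K S\<^esub> F) \<oplus>\<^bsub>free_module K S\<^esub> F = \<zero>\<^bsub>free_module K S\<^esub>"
        by (rule free_module_eqI[of _ K S]) (use F in \<open>auto simp: K.l_minus K.l_neg\<close>)
      with F show "\<exists>G\<in>carrier (free_module K S). G \<oplus>\<^bsub>free_module K S\<^esub> F = \<zero>\<^bsub>free_module K S\<^esub>"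
        by (meson cl(2) K.a_inv_closed K.one_closed)
    next
      fix F G H assume *: "F \<in> carrier (free_module K S)" "G \<in> carrier (free_module K S)"
        "H \<in> carrier (free_module K S)"
      show "F \<oplus>\<^bsub>free_module K S\<^esub> G \<oplus>\<^bsub>free_module K S\<^esub> H
          = F \<oplus>\<^bsub>free_module K S\<^esub> (G \<oplus>\<^bsub>free_module K S\<^esub> H)"
        by (rule free_module_eqI[of _ K S]) (use * in \<open>auto simp: K.a_assoc\<close>)
      show "F \<oplus>\<^bsub>free_module K S\<^esub> G = G \<oplus>\<^bsub>free_module K S\<^esub> F"
        by (rule free_module_eqI[of _ K S]) (use * in \<open>auto simp: K.a_comm\<close>)
      show "\<zero>\<^bsub>free_module K S\<^esub> \<oplus>\<^bsub>free_module K S\<^esub> F = F"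
        by (rule free_module_eqI[of _ K S]) (use * in auto)
    qed auto
  qed (auto intro!: free_module_eqI[of _ K S] simp: assms K.l_distr K.r_distr K.m_assoc)
qed

text \<open>Remove the points of the support of \<open>F\<close> one at a time: removing one subtracts a
  multiple of a generator.\<close>

lemma free_module_induct [consumes 2, case_names zero gen add smult]:
  assumes "cring K" and "F \<in> carrier (free_module K S)"
    and zero: "P \<zero>\<^bsub>free_module K S\<^esub>"
    and gen: "\<And>s. s \<in> S \<Longrightarrow> P (free_gen K S s)"
    and add: "\<And>F G. \<lbrakk>F \<in> carrier (free_module K S); G \<in> carrier (free_module K S); P F; P G\<rbrakk>
      \<Longrightarrow> P (F \<oplus>\<^bsub>free_module K S\<^esub> G)"
    and smult: "\<And>r F. \<lbrakk>r \<in> carrier K; F \<in> carrier (free_module K S); P F\<rbrakk>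
      \<Longrightarrow> P (r \<odot>\<^bsub>free_module K S\<^esub> F)"
  shows "P F"
proof -
  interpret K: cring K by fact
  note cl = free_module_closed[OF assms(1)]
  have fin: "finite {s \<in> S. F s \<noteq> \<zero>\<^bsub>K\<^esub>}" using assms(2) by (simp add: free_module_carrier_iff)
  have "P F" if "finite T" "F \<in> carrier (free_module K S)" "{s \<in> S. F s \<noteq> \<zero>\<^bsub>K\<^esub>} \<subseteq> T" for F T
    using that
  proof (induction T arbitrary: F rule: finite_induct)
    case empty
    then have "F = \<zero>\<^bsub>free_module K S\<^esub>"
      by (intro free_module_eqI[of F K S]) (auto simp: cl free_module_ops)
    with zero show ?case by simp
  next
    case (insert t T)
    note F = insert.prems(1)
    show ?case
    proof (cases "t \<in> S")
      case False
      with insert.prems have "{s \<in> S. F s \<noteq> \<zero>\<^bsub>K\<^esub>} \<subseteq> T" by auto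
      with insert.IH F show ?thesis by blast
    next
      case True
      define G where "G = (\<lambda>s\<in>S. if s = t then \<zero>\<^bsub>K\<^esub> else F s)"
      have Gsub: "{s \<in> S. G s \<noteq> \<zero>\<^bsub>K\<^esub>} \<subseteq> T"
        using insert.prems(2) by (auto simp: G_def)
      have G: "G \<in> carrier (free_module K S)"
        using F finite_subset[OF Gsub insert.hyps(1)]
        by (auto simp: G_def free_module_carrier_iff)
      have "F = (F t \<odot>\<^bsub>free_module K S\<^esub> free_gen K S t) \<oplus>\<^bsub>free_module K S\<^esub> G"
        (is "F = ?H")
      proof (rule free_module_eqI[of F K S])
        show "?H \<in> carrier (free_module K S)"
          using F G True by (simp add: cl free_module_apply)
        show "F s = ?H s" if "s \<in> S" for s
          using that F True free_module_apply[OF F that] free_module_apply[OF F True]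
          by (auto simp: free_module_ops free_gen_def G_def)
      qed (rule F)
      moreover have "P G" using insert.IH[OF G Gsub] .
      ultimately show ?thesis
        using F G True by (metis add cl(2,4) free_module_apply gen smult)
    qed
  qed
  from this[OF fin assms(2)] show ?thesis by simp
qed

text \<open>The linear extension of a family \<open>b\<close> is written with the support of \<open>F\<close>, which varies
  with \<open>F\<close>; summing over any larger finite set gives the same value, and that makes it additive.\<close>

lemma free_extension_linear:
  assumes "module K P" and b: "\<And>s. s \<in> S \<Longrightarrow> b s \<in> carrier P"
  shows "(\<lambda>F. \<Oplus>\<^bsub>P\<^esub> s \<in> {s \<in> S. F s \<noteq> \<zero>\<^bsub>K\<^esub>}. F s \<odot>\<^bsub>P\<^esub> b s) \<in> linear_maps K (free_module K S) P"
    (is "?ext \<in> _")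
proof -
  interpret P: module K P by fact
  note cl = free_module_closed[OF P.R.is_cring]
  have ext: "?ext F = (\<Oplus>\<^bsub>P\<^esub> s \<in> T. F s \<odot>\<^bsub>P\<^esub> b s)"
    if "F \<in> carrier (free_module K S)" "finite T" "{s \<in> S. F s \<noteq> \<zero>\<^bsub>K\<^esub>} \<subseteq> T" "T \<subseteq> S" for F T
    by (rule P.add.finprod_mono_neutral_cong_left)
      (use that b in \<open>auto simp: free_module_apply subset_iff\<close>)
  have fin: "finite {s \<in> S. F s \<noteq> \<zero>\<^bsub>K\<^esub>}" if "F \<in> carrier (free_module K S)" for F
    using that by (simp add: free_module_carrier_iff)
  show ?thesis
  proof (rule linear_mapsI)
    fix F assume "F \<in> carrier (free_module K S)"
    then show "?ext F \<in> carrier P"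
      using b by (intro P.finsum_closed) (auto simp: free_module_apply)
  next
    fix F G assume F: "F \<in> carrier (free_module K S)" and G: "G \<in> carrier (free_module K S)"
    let ?T = "{s \<in> S. F s \<noteq> \<zero>\<^bsub>K\<^esub>} \<union> {s \<in> S. G s \<noteq> \<zero>\<^bsub>K\<^esub>}"
    have T: "finite ?T" "?T \<subseteq> S" using fin[OF F] fin[OF G] by auto
    have "?ext (F \<oplus>\<^bsub>free_module K S\<^esub> G) = (\<Oplus>\<^bsub>P\<^esub> s \<in> ?T. (F \<oplus>\<^bsub>free_module K S\<^esub> G) s \<odot>\<^bsub>P\<^esub> b s)"
      by (rule ext) (use F G T in \<open>auto simp: cl free_module_ops free_module_apply\<close>)
    also have "\<dots> = (\<Oplus>\<^bsub>P\<^esub> s \<in> ?T. F s \<odot>\<^bsub>P\<^esub> b s \<oplus>\<^bsub>P\<^esub> G s \<odot>\<^bsub>P\<^esub> b s)"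
      by (rule P.add.finprod_cong')
        (use F G b in \<open>auto simp: free_module_ops free_module_apply P.smult_l_distr\<close>)
    also have "\<dots> = (\<Oplus>\<^bsub>P\<^esub> s \<in> ?T. F s \<odot>\<^bsub>P\<^esub> b s) \<oplus>\<^bsub>P\<^esub> (\<Oplus>\<^bsub>P\<^esub> s \<in> ?T. G s \<odot>\<^bsub>P\<^esub> b s)"
      by (rule P.finsum_addf) (use F G b in \<open>auto simp: free_module_apply\<close>)
    also have "\<dots> = ?ext F \<oplus>\<^bsub>P\<^esub> ?ext G"
      using ext[OF F T(1) _ T(2)] ext[OF G T(1) _ T(2)] by auto
    finally show "?ext (F \<oplus>\<^bsub>free_module K S\<^esub> G) = ?ext F \<oplus>\<^bsub>P\<^esub> ?ext G" .
  next
    fix r F assume r: "r \<in> carrier K" and F: "F \<in> carrier (free_module K S)"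
    let ?T = "{s \<in> S. F s \<noteq> \<zero>\<^bsub>K\<^esub>}"
    have "?ext (r \<odot>\<^bsub>free_module K S\<^esub> F) = (\<Oplus>\<^bsub>P\<^esub> s \<in> ?T. (r \<odot>\<^bsub>free_module K S\<^esub> F) s \<odot>\<^bsub>P\<^esub> b s)"
      by (rule ext) (use r F fin[OF F] in \<open>auto simp: cl free_module_ops\<close>)
    also have "\<dots> = (\<Oplus>\<^bsub>P\<^esub> s \<in> ?T. r \<odot>\<^bsub>P\<^esub> (F s \<odot>\<^bsub>P\<^esub> b s))"
      by (rule P.add.finprod_cong')
        (use r F b in \<open>auto simp: free_module_ops free_module_apply P.smult_assoc1\<close>)
    also have "\<dots> = r \<odot>\<^bsub>P\<^esub> ?ext F"
      by (rule P.finsum_smult_ldistr[symmetric])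
        (use r F b fin[OF F] in \<open>auto simp: free_module_apply\<close>)
    finally show "?ext (r \<odot>\<^bsub>free_module K S\<^esub> F) = r \<odot>\<^bsub>P\<^esub> ?ext F" .
  qed
qed

lemma free_extension_gen:
  assumes "module K P" "s \<in> S" "b s \<in> carrier P"
  shows "(\<Oplus>\<^bsub>P\<^esub> t \<in> {t \<in> S. free_gen K S s t \<noteq> \<zero>\<^bsub>K\<^esub>}. free_gen K S s t \<odot>\<^bsub>P\<^esub> b t) = b s"
proof -
  interpret P: module K P by fact
  show ?thesis
  proof (cases "\<one>\<^bsub>K\<^esub> = \<zero>\<^bsub>K\<^esub>")
    \<comment> \<open>Over the zero ring every generator has empty support, and \<open>P\<close> is the zero module.\<close>
    case True
    have "b s = \<zero>\<^bsub>P\<^esub>" using P.smult_one[OF assms(3)] P.smult_l_null[OF assms(3)] True by simp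
    moreover have "{t \<in> S. free_gen K S s t \<noteq> \<zero>\<^bsub>K\<^esub>} = {}" using True by (auto simp: free_gen_def)
    ultimately show ?thesis by (simp only: P.finsum_empty)
  next
    case False
    then have "{t \<in> S. free_gen K S s t \<noteq> \<zero>\<^bsub>K\<^esub>} = {s}" using assms(2) by (auto simp: free_gen_def)
    moreover have "(\<Oplus>\<^bsub>P\<^esub> t \<in> {s}. free_gen K S s t \<odot>\<^bsub>P\<^esub> b t) = b s"
      using assms by (simp add: free_gen_def)
    ultimately show ?thesis by (simp only:)
  qed
qed


section \<open>Building linear maps\<close>

lemma linear_cong:
  assumes "module K M" "\<And>x. x \<in> carrier M \<Longrightarrow> f x = g x" "g \<in> linear_maps K M N"
  shows "f \<in> linear_maps K M N"
proof -
  interpret M: module K M by fact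
  show ?thesis
    by (rule linear_mapsI)
      (use assms(2) linear_closed[OF assms(3)] linear_add[OF assms(3)] linear_smult[OF assms(3)]
        in auto)
qed

lemma linear_ident: "(\<lambda>x. x) \<in> linear_maps K M M"
  by (rule linear_mapsI) auto

lemma linear_compose:
  "\<lbrakk>f \<in> linear_maps K M N; g \<in> linear_maps K L M\<rbrakk> \<Longrightarrow> (\<lambda>x. f (g x)) \<in> linear_maps K L N"
  unfolding linear_maps_def by (auto simp: Pi_iff)

lemma linear_plus:
  assumes "module K N" "f \<in> linear_maps K M N" "g \<in> linear_maps K M N"
  shows "(\<lambda>x. f x \<oplus>\<^bsub>N\<^esub> g x) \<in> linear_maps K M N"
proof -
  interpret N: module K N by fact
  show ?thesis
    by (rule linear_mapsI)
      (simp_all add: linear_closed[OF assms(2)] linear_closed[OF assms(3)]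
        linear_add[OF assms(2)] linear_add[OF assms(3)]
        linear_smult[OF assms(2)] linear_smult[OF assms(3)] N.smult_r_distr N.a_ac)
qed

lemma linear_scale:
  assumes "module K N" "r \<in> carrier K" "f \<in> linear_maps K M N"
  shows "(\<lambda>x. r \<odot>\<^bsub>N\<^esub> f x) \<in> linear_maps K M N"
proof -
  interpret N: module K N by fact
  show ?thesis
    by (rule linear_mapsI)
      (simp_all add: assms(2) linear_closed[OF assms(3)] linear_add[OF assms(3)]
        linear_smult[OF assms(3)] N.smult_r_distr N.R.m_comm flip: N.smult_assoc1)
qed

lemma linear_scale_functional:
  assumes "module K N" "e \<in> linear_maps K M (ring_as_module K)" "n \<in> carrier N"
  shows "(\<lambda>x. e x \<odot>\<^bsub>N\<^esub> n) \<in> linear_maps K M N"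
proof -
  interpret N: module K N by fact
  have "e x \<in> carrier K" if "x \<in> carrier M" for x
    using linear_closed[OF assms(2) that] by (simp add: ring_as_module_def)
  then show ?thesis
    by (intro linear_mapsI)
      (simp_all add: assms(3) linear_add[OF assms(2)] linear_smult[OF assms(2)] ring_as_module_def
        N.smult_l_distr N.smult_assoc1)
qed

lemma linear_bilinear_left:
  "\<lbrakk>b \<in> bilinear_maps K M N P; g \<in> linear_maps K L M; n \<in> carrier N\<rbrakk>
    \<Longrightarrow> (\<lambda>x. b (g x) n) \<in> linear_maps K L P"
  using linear_compose[OF bilinear_left] .

lemma linear_bilinear_right:
  "\<lbrakk>b \<in> bilinear_maps K M N P; g \<in> linear_maps K L N; m \<in> carrier M\<rbrakk>
    \<Longrightarrow> (\<lambda>x. b m (g x)) \<in> linear_maps K L P"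
  using linear_compose[OF bilinear_right] .

lemma linear_restrict:
  assumes "module K M" "f \<in> linear_maps K M N"
  shows "restrict f (carrier M) \<in> linear_maps K M N"
  by (rule linear_cong[OF assms(1) _ assms(2)]) simp

lemma linear_inverse:
  assumes "module K M" "f \<in> linear_maps K M M" "bij_betw f (carrier M) (carrier M)"
  shows "aut_inv M f \<in> linear_maps K M M"
proof -
  interpret M: module K M by fact
  let ?g = "aut_inv M f"
  have g: "?g x \<in> carrier M" "f (?g x) = x" if "x \<in> carrier M" for x
    using that assms(3) by (auto simp: bij_betw_def inv_into_into f_inv_into_f)
  have gf: "?g (f x) = x" if "x \<in> carrier M" for x
    using that assms(3) by (auto simp: bij_betw_def inv_into_f_f)
  show ?thesis
  proof (rule linear_mapsI)
    show "?g (x \<oplus>\<^bsub>M\<^esub> y) = ?g x \<oplus>\<^bsub>M\<^esub> ?g y" if "x \<in> carrier M" "y \<in> carrier M" for x y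
      using gf[of "?g x \<oplus>\<^bsub>M\<^esub> ?g y"] g that by (simp add: linear_add[OF assms(2)])
    show "?g (r \<odot>\<^bsub>M\<^esub> x) = r \<odot>\<^bsub>M\<^esub> ?g x" if "r \<in> carrier K" "x \<in> carrier M" for r x
      using gf[of "r \<odot>\<^bsub>M\<^esub> ?g x"] g that by (simp add: linear_smult[OF assms(2)])
  qed (rule g)
qed


section \<open>Tensor products\<close>

lemma tensor_rels_subset:
  assumes "module K M" "module K N"
  shows "tensor_rels K M N \<subseteq> carrier (free_module K (carrier M \<times> carrier N))"
proof -
  interpret M: module K M by fact
  interpret N: module K N by fact
  interpret F: module K "free_module K (carrier M \<times> carrier N)"
    by (rule free_module_module[OF M.R.is_cring])
  show ?thesis
    unfolding tensor_rels_def Let_def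
    by (auto intro!: F.minus_closed F.add.m_closed F.smult_closed
        free_module_closed(4)[OF M.R.is_cring])
qed

lemma tensor_quotient:
  assumes "module K M" "module K N"
  shows "quotient_module K (free_module K (carrier M \<times> carrier N)) (tensor_null K M N)"
proof -
  have F: "module K (free_module K (carrier M \<times> carrier N))"
    by (rule free_module_module[OF module.axioms(1)[OF assms(1)]])
  show ?thesis
    unfolding tensor_null_def
    by (rule quotient_module.intro[OF F submodule_span_submodule[OF F tensor_rels_subset[OF assms]]])
qed

lemma tensor_module: "\<lbrakk>module K M; module K N\<rbrakk> \<Longrightarrow> module K (tensor K M N)"
  unfolding tensor_def by (rule quotient_module.quot_module[OF tensor_quotient])

lemma tens_bilinear:
  assumes "module K M" "module K N"
  shows "tens K M N \<in> bilinear_maps K M N (tensor K M N)"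
proof -
  let ?F = "free_module K (carrier M \<times> carrier N)"
  let ?g = "free_gen K (carrier M \<times> carrier N)"
  interpret M: module K M by fact
  interpret N: module K N by fact
  interpret Q: quotient_module K ?F "tensor_null K M N" by (rule tensor_quotient[OF assms])
  have g: "?g (x, y) \<in> carrier ?F" if "x \<in> carrier M" "y \<in> carrier N" for x y
    using that by (intro free_module_closed(4)[OF M.R.is_cring]) auto
  have null: "tensor_rels K M N \<subseteq> tensor_null K M N"
    unfolding tensor_null_def by (rule submodule_span_superset)
  have rel: "F \<ominus>\<^bsub>?F\<^esub> G \<in> tensor_rels K M N
      \<Longrightarrow> F \<in> carrier ?F \<Longrightarrow> G \<in> carrier ?F
      \<Longrightarrow> tensor_null K M N +>\<^bsub>?F\<^esub> F = tensor_null K M N +>\<^bsub>?F\<^esub> G" for F G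
    using Q.coset_eqI null by blast
  have "tens K M N (x \<oplus>\<^bsub>M\<^esub> x') y = tens K M N x y \<oplus>\<^bsub>tensor K M N\<^esub> tens K M N x' y"
    if "x \<in> carrier M" "x' \<in> carrier M" "y \<in> carrier N" for x x' y
    unfolding tens_def tensor_def Q.coset_add[OF g[OF that(1,3)] g[OF that(2,3)]]
    by (rule rel, unfold tensor_rels_def Let_def)
      (use that in \<open>blast | simp add: g\<close>)+
  moreover have "tens K M N x (y \<oplus>\<^bsub>N\<^esub> y') = tens K M N x y \<oplus>\<^bsub>tensor K M N\<^esub> tens K M N x y'"
    if "x \<in> carrier M" "y \<in> carrier N" "y' \<in> carrier N" for x y y'
    unfolding tens_def tensor_def Q.coset_add[OF g[OF that(1,2)] g[OF that(1,3)]]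
    by (rule rel, unfold tensor_rels_def Let_def)
      (use that in \<open>blast | simp add: g\<close>)+
  moreover have "tens K M N (r \<odot>\<^bsub>M\<^esub> x) y = r \<odot>\<^bsub>tensor K M N\<^esub> tens K M N x y"
    if "r \<in> carrier K" "x \<in> carrier M" "y \<in> carrier N" for r x y
    unfolding tens_def tensor_def Q.coset_smult[OF that(1) g[OF that(2,3)]]
    by (rule rel, unfold tensor_rels_def Let_def)
      (use that in \<open>blast | simp add: g\<close>)+
  moreover have "tens K M N x (r \<odot>\<^bsub>N\<^esub> y) = r \<odot>\<^bsub>tensor K M N\<^esub> tens K M N x y"
    if "r \<in> carrier K" "x \<in> carrier M" "y \<in> carrier N" for r x y
    unfolding tens_def tensor_def Q.coset_smult[OF that(1) g[OF that(2,3)]]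
    by (rule rel, unfold tensor_rels_def Let_def)
      (use that in \<open>blast | simp add: g\<close>)+
  moreover have "tens K M N x y \<in> carrier (tensor K M N)"
    if "x \<in> carrier M" "y \<in> carrier N" for x y
    unfolding tens_def tensor_def using Q.coset_in_carrier[OF g[OF that]] .
  ultimately show ?thesis
    unfolding bilinear_maps_def by (auto intro!: linear_mapsI)
qed

lemma tens_closed: "\<lbrakk>module K M; module K N; x \<in> carrier M; y \<in> carrier N\<rbrakk>
    \<Longrightarrow> tens K M N x y \<in> carrier (tensor K M N)"
  using bilinear_closed[OF tens_bilinear] .

lemma tensor_induct [consumes 3, case_names zero tens add smult]:
  assumes "module K M" "module K N" and t: "t \<in> carrier (tensor K M N)"
    and zero: "Q \<zero>\<^bsub>tensor K M N\<^esub>"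
    and tens: "\<And>x y. \<lbrakk>x \<in> carrier M; y \<in> carrier N\<rbrakk> \<Longrightarrow> Q (tens K M N x y)"
    and add: "\<And>s t. \<lbrakk>s \<in> carrier (tensor K M N); t \<in> carrier (tensor K M N); Q s; Q t\<rbrakk>
      \<Longrightarrow> Q (s \<oplus>\<^bsub>tensor K M N\<^esub> t)"
    and smult: "\<And>r t. \<lbrakk>r \<in> carrier K; t \<in> carrier (tensor K M N); Q t\<rbrakk>
      \<Longrightarrow> Q (r \<odot>\<^bsub>tensor K M N\<^esub> t)"
  shows "Q t"
proof -
  let ?F = "free_module K (carrier M \<times> carrier N)"
  interpret M: module K M by fact
  interpret Q: quotient_module K ?F "tensor_null K M N" by (rule tensor_quotient[OF assms(1,2)])
  obtain F where F: "F \<in> carrier ?F" and tF: "t = tensor_null K M N +>\<^bsub>?F\<^esub> F"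
    using t unfolding tensor_def by (rule Q.carrierE)
  from M.R.is_cring F have "Q (tensor_null K M N +>\<^bsub>?F\<^esub> F)"
  proof (induction F rule: free_module_induct)
    case zero
    from assms(4) show ?case unfolding tensor_def by (simp add: Q.coset_zero)
  next
    case (gen s)
    with tens[of "fst s" "snd s"] show ?case by (auto simp: tens_def)
  next
    case (add F G)
    with assms(6)[of "tensor_null K M N +>\<^bsub>?F\<^esub> F" "tensor_null K M N +>\<^bsub>?F\<^esub> G"]
    show ?case by (simp add: tensor_def Q.coset_add Q.coset_in_carrier)
  next
    case (smult r F)
    with assms(7)[of r "tensor_null K M N +>\<^bsub>?F\<^esub> F"]
    show ?case by (simp add: tensor_def Q.coset_smult Q.coset_in_carrier)
  qed
  with tF show ?thesis by simp
qed

text \<open>The elementary tensors span, so it suffices to compare linear maps on them.\<close>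

lemma tensor_linear_eqI:
  assumes "module K M" "module K N" "module K P"
    and f: "f \<in> linear_maps K (tensor K M N) P" and g: "g \<in> linear_maps K (tensor K M N) P"
    and eq: "\<And>x y. \<lbrakk>x \<in> carrier M; y \<in> carrier N\<rbrakk> \<Longrightarrow> f (tens K M N x y) = g (tens K M N x y)"
    and t: "t \<in> carrier (tensor K M N)"
  shows "f t = g t"
  using assms(1,2) t
  by (induction t rule: tensor_induct)
    (simp_all add: eq linear_zero[OF tensor_module[OF assms(1,2)] assms(3)] f g
      linear_add[OF f] linear_add[OF g] linear_smult[OF f] linear_smult[OF g])

lemma
  assumes "module K M" "module K N" "module K P" "b \<in> bilinear_maps K M N P"
  shows tensor_lift_linear: "tensor_lift K M N P b \<in> linear_maps K (tensor K M N) P"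
    and tensor_lift_tens: "\<lbrakk>x \<in> carrier M; y \<in> carrier N\<rbrakk>
      \<Longrightarrow> tensor_lift K M N P b (tens K M N x y) = b x y"
proof -
  let ?S = "carrier M \<times> carrier N"
  let ?F = "free_module K ?S"
  let ?ext = "\<lambda>F. \<Oplus>\<^bsub>P\<^esub> p \<in> {p \<in> ?S. F p \<noteq> \<zero>\<^bsub>K\<^esub>}. F p \<odot>\<^bsub>P\<^esub> b (fst p) (snd p)"
  interpret M: module K M by fact
  interpret N: module K N by fact
  interpret P: module K P by fact
  interpret Q: quotient_module K ?F "tensor_null K M N" by (rule tensor_quotient[OF assms(1,2)])
  have bcl: "b x y \<in> carrier P" if "x \<in> carrier M" "y \<in> carrier N" for x y
    using bilinear_closed[OF assms(4) that] .
  have ext: "?ext \<in> linear_maps K ?F P"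
    by (rule free_extension_linear[OF assms(3)]) (auto simp: bcl)
  have gen: "?ext (free_gen K ?S (x, y)) = b x y" if "x \<in> carrier M" "y \<in> carrier N" for x y
    using free_extension_gen[OF assms(3), of "(x, y)" ?S "\<lambda>p. b (fst p) (snd p)"] that bcl by auto
  have gcl: "free_gen K ?S (x, y) \<in> carrier ?F" if "x \<in> carrier M" "y \<in> carrier N" for x y
    using that by (intro free_module_closed(4)[OF M.R.is_cring]) auto
  define e where "e = ?ext"
  have e: "e \<in> linear_maps K ?F P"
    unfolding e_def by (rule ext)
  have e_gen: "e (free_gen K ?S (x, y)) = b x y" if "x \<in> carrier M" "y \<in> carrier N" for x y
    unfolding e_def using that by (rule gen)
  have self: "p \<ominus>\<^bsub>P\<^esub> p = \<zero>\<^bsub>P\<^esub>" if "p \<in> carrier P" for p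
    using that by (simp add: a_minus_def P.r_neg)
  have rel: "e F = \<zero>\<^bsub>P\<^esub>" if "F \<in> tensor_rels K M N" for F
    using that unfolding tensor_rels_def Let_def
    by (elim UnE CollectE exE conjE)
      (simp_all add: linear_diff[OF Q.mod assms(3) e] linear_add[OF e] linear_smult[OF e]
        e_gen gcl bcl linear_add[OF bilinear_left[OF assms(4)]]
        linear_add[OF bilinear_right[OF assms(4)]] linear_smult[OF bilinear_left[OF assms(4)]]
        linear_smult[OF bilinear_right[OF assms(4)]] self)
  have null: "?ext F = \<zero>\<^bsub>P\<^esub>" if "F \<in> tensor_null K M N" for F
    using linear_zero_on_span[OF Q.mod assms(3) e tensor_rels_subset[OF assms(1,2)] rel] that
    unfolding tensor_null_def e_def by blast
  show "tensor_lift K M N P b \<in> linear_maps K (tensor K M N) P"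
    using Q.lift_linear[OF assms(3) ext null] unfolding tensor_lift_def tensor_def .
  show "tensor_lift K M N P b (tens K M N x y) = b x y" if "x \<in> carrier M" "y \<in> carrier N"
    unfolding tensor_lift_def tens_def
    using Q.lift_coset[OF assms(3) ext null gcl[OF that]] gen[OF that] by simp
qed

lemma tensor_lift_closed:
  "\<lbrakk>module K M; module K N; module K P; b \<in> bilinear_maps K M N P; t \<in> carrier (tensor K M N)\<rbrakk>
    \<Longrightarrow> tensor_lift K M N P b t \<in> carrier P"
  using linear_closed[OF tensor_lift_linear] .

lemma linear_tensor_lift_arg:
  "\<lbrakk>module K M; module K N; module K P; b \<in> bilinear_maps K M N P;
    g \<in> linear_maps K L (tensor K M N)\<rbrakk>
    \<Longrightarrow> (\<lambda>x. tensor_lift K M N P b (g x)) \<in> linear_maps K L P"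
  using linear_compose[OF tensor_lift_linear] .

text \<open>A Sweedler sum is linear also in a parameter \<open>x\<close> of its summand: additivity in \<open>x\<close> is an identity
  between linear maps of \<open>t\<close>, and can be checked on elementary tensors.\<close>

lemma linear_tensor_lift_body:
  assumes "module K L" "module K M" "module K N" "module K P"
    and b: "\<And>x. x \<in> carrier L \<Longrightarrow> b x \<in> bilinear_maps K M N P"
    and lin: "\<And>m n. \<lbrakk>m \<in> carrier M; n \<in> carrier N\<rbrakk> \<Longrightarrow> (\<lambda>x. b x m n) \<in> linear_maps K L P"
    and t: "t \<in> carrier (tensor K M N)"
  shows "(\<lambda>x. tensor_lift K M N P (b x) t) \<in> linear_maps K L P"
proof -
  interpret L: module K L by fact
  note lift = tensor_lift_linear[OF assms(2-4) b]
  note simps = tensor_lift_tens[OF assms(2-4) b] linear_add[OF lin] linear_smult[OF lin]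
  show ?thesis
  proof (rule linear_mapsI)
    fix x assume "x \<in> carrier L"
    then show "tensor_lift K M N P (b x) t \<in> carrier P"
      using linear_closed[OF lift _] t by auto
  next
    fix x y assume xy: "x \<in> carrier L" "y \<in> carrier L"
    show "tensor_lift K M N P (b (x \<oplus>\<^bsub>L\<^esub> y)) t
        = tensor_lift K M N P (b x) t \<oplus>\<^bsub>P\<^esub> tensor_lift K M N P (b y) t"
      by (rule tensor_linear_eqI[OF assms(2-4) lift linear_plus[OF assms(4) lift lift] _ t])
        (use xy in \<open>simp_all add: simps\<close>)
  next
    fix r x assume rx: "r \<in> carrier K" "x \<in> carrier L"
    show "tensor_lift K M N P (b (r \<odot>\<^bsub>L\<^esub> x)) t = r \<odot>\<^bsub>P\<^esub> tensor_lift K M N P (b x) t"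
      by (rule tensor_linear_eqI[OF assms(2-4) lift linear_scale[OF assms(4) rx(1) lift] _ t])
        (use rx in \<open>simp_all add: simps\<close>)
  qed
qed

text \<open>The next two rules are what makes Sweedler notation work: a linear map may be moved under
  the summation sign, and the summand may be rewritten.\<close>

lemma linear_tensor_lift:
  assumes "module K M" "module K N" "module K P" "module K Q"
    and "f \<in> linear_maps K P Q" "b \<in> bilinear_maps K M N P" "t \<in> carrier (tensor K M N)"
  shows "f (tensor_lift K M N P b t) = tensor_lift K M N Q (\<lambda>x y. f (b x y)) t"
proof -
  have fb: "(\<lambda>x y. f (b x y)) \<in> bilinear_maps K M N Q"
    by (intro bilinear_mapsI linear_compose[OF assms(5)] bilinear_left[OF assms(6)]
        bilinear_right[OF assms(6)])
  show ?thesis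
    by (rule tensor_linear_eqI[OF assms(1,2,4) linear_compose[OF assms(5)
          tensor_lift_linear[OF assms(1-3,6)]] tensor_lift_linear[OF assms(1,2,4) fb] _ assms(7)])
      (simp add: tensor_lift_tens[OF assms(1-3,6)] tensor_lift_tens[OF assms(1,2,4) fb])
qed

lemma tensor_lift_cong:
  assumes "module K M" "module K N" "module K P"
    and eq: "\<And>x y. \<lbrakk>x \<in> carrier M; y \<in> carrier N\<rbrakk> \<Longrightarrow> b x y = b' x y"
    and b: "b \<in> bilinear_maps K M N P" and t: "t \<in> carrier (tensor K M N)"
  shows "tensor_lift K M N P b t = tensor_lift K M N P b' t"
proof -
  have "(\<lambda>x y. b' x y) \<in> bilinear_maps K M N P"
  proof (rule bilinear_mapsI)
    show "(\<lambda>y. b' x y) \<in> linear_maps K N P" if "x \<in> carrier M" for x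
      by (rule linear_cong[OF assms(2) _ bilinear_right[OF b that]]) (simp add: eq that)
    show "(\<lambda>x. b' x y) \<in> linear_maps K M P" if "y \<in> carrier N" for y
      by (rule linear_cong[OF assms(1) _ bilinear_left[OF b that]]) (simp add: eq that)
  qed
  then have b': "b' \<in> bilinear_maps K M N P" by simp
  show ?thesis
    by (rule tensor_linear_eqI[OF assms(1-3) tensor_lift_linear[OF assms(1-3) b]
          tensor_lift_linear[OF assms(1-3) b'] _ t])
      (simp add: tensor_lift_tens[OF assms(1-3)] b b' eq)
qed

text \<open>The two preceding rules in one step.  Applied repeatedly, it carries a linear map through nested
  Sweedler sums down to the innermost summand.\<close>

lemma linear_tensor_lift_cong:
  assumes "module K M" "module K N" "module K P" "module K Q"
    and f: "f \<in> linear_maps K P Q" and b: "b \<in> bilinear_maps K M N P"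
    and t: "t \<in> carrier (tensor K M N)"
    and eq: "\<And>x y. \<lbrakk>x \<in> carrier M; y \<in> carrier N\<rbrakk> \<Longrightarrow> f (b x y) = b' x y"
  shows "f (tensor_lift K M N P b t) = tensor_lift K M N Q b' t"
proof -
  have fb: "(\<lambda>x y. f (b x y)) \<in> bilinear_maps K M N Q"
    by (intro bilinear_mapsI linear_compose[OF f] bilinear_left[OF b] bilinear_right[OF b])
  show ?thesis
    unfolding linear_tensor_lift[OF assms(1-4) f b t]
    by (rule tensor_lift_cong[OF assms(1,2,4) eq fb t])
qed

text \<open>Trilinearity is split as "bilinear for each first argument" to match the bracketing
  \<open>L \<otimes> (M \<otimes> N)\<close> in which Hom-coassociativity is stated.\<close>

definition trilinear_maps :: "'k ring \<Rightarrow> ('k, 'l) module \<Rightarrow> ('k, 'm) module \<Rightarrow> ('k, 'n) module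
    \<Rightarrow> ('k, 'p) module \<Rightarrow> ('l \<Rightarrow> 'm \<Rightarrow> 'n \<Rightarrow> 'p) set" where
  "trilinear_maps K L M N P = {b.
     (\<forall>x\<in>carrier L. b x \<in> bilinear_maps K M N P) \<and>
     (\<forall>y\<in>carrier M. \<forall>z\<in>carrier N. (\<lambda>x. b x y z) \<in> linear_maps K L P)}"

lemma trilinear_mapsI:
  assumes "\<And>x y. \<lbrakk>x \<in> carrier L; y \<in> carrier M\<rbrakk> \<Longrightarrow> (\<lambda>z. b x y z) \<in> linear_maps K N P"
    and "\<And>x z. \<lbrakk>x \<in> carrier L; z \<in> carrier N\<rbrakk> \<Longrightarrow> (\<lambda>y. b x y z) \<in> linear_maps K M P"
    and "\<And>y z. \<lbrakk>y \<in> carrier M; z \<in> carrier N\<rbrakk> \<Longrightarrow> (\<lambda>x. b x y z) \<in> linear_maps K L P"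
  shows "(\<lambda>x y z. b x y z) \<in> trilinear_maps K L M N P"
  using assms unfolding trilinear_maps_def bilinear_maps_def by auto

lemma trilinear_1: "\<lbrakk>b \<in> trilinear_maps K L M N P; x \<in> carrier L\<rbrakk> \<Longrightarrow> b x \<in> bilinear_maps K M N P"
  and trilinear_23: "\<lbrakk>b \<in> trilinear_maps K L M N P; y \<in> carrier M; z \<in> carrier N\<rbrakk>
    \<Longrightarrow> (\<lambda>x. b x y z) \<in> linear_maps K L P"
  unfolding trilinear_maps_def by auto

lemma trilinear_lift:
  assumes "module K L" "module K M" "module K N" "module K P" "b \<in> trilinear_maps K L M N P"
  shows "(\<lambda>x t. tensor_lift K M N P (b x) t) \<in> bilinear_maps K L (tensor K M N) P"
  by (rule bilinear_mapsI)
    (auto intro: tensor_lift_linear linear_tensor_lift_body assms trilinear_1[OF assms(5)]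
      trilinear_23[OF assms(5)])

lemma trilinear_liftE:
  assumes "module K L" "module K M" "module K N" "module K P" "b \<in> trilinear_maps K L M N P"
  obtains f where "f \<in> linear_maps K (tensor K L (tensor K M N)) P"
    and "\<And>x t. \<lbrakk>x \<in> carrier L; t \<in> carrier (tensor K M N)\<rbrakk>
      \<Longrightarrow> f (tens K L (tensor K M N) x t) = tensor_lift K M N P (b x) t"
    and "\<And>x y z. \<lbrakk>x \<in> carrier L; y \<in> carrier M; z \<in> carrier N\<rbrakk>
      \<Longrightarrow> f (tens K L (tensor K M N) x (tens K M N y z)) = b x y z"
proof
  let ?f = "tensor_lift K L (tensor K M N) P (\<lambda>x t. tensor_lift K M N P (b x) t)"
  note bil = trilinear_lift[OF assms]
  show "?f \<in> linear_maps K (tensor K L (tensor K M N)) P"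
    by (rule tensor_lift_linear[OF assms(1) tensor_module[OF assms(2,3)] assms(4) bil])
  show eq: "?f (tens K L (tensor K M N) x t) = tensor_lift K M N P (b x) t"
    if "x \<in> carrier L" "t \<in> carrier (tensor K M N)" for x t
    by (rule tensor_lift_tens[OF assms(1) tensor_module[OF assms(2,3)] assms(4) bil that])
  show "?f (tens K L (tensor K M N) x (tens K M N y z)) = b x y z"
    if "x \<in> carrier L" "y \<in> carrier M" "z \<in> carrier N" for x y z
    unfolding eq[OF that(1) tens_closed[OF assms(2,3) that(2,3)]]
    by (rule tensor_lift_tens[OF assms(2-4) trilinear_1[OF assms(5) that(1)] that(2,3)])
qed


section \<open>Sweedler calculus\<close>

context hom_entwining
begin

abbreviation CC where "CC \<equiv> tensor K C C"
abbreviation AC where "AC \<equiv> tensor K A C"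

abbreviation \<alpha>i where "\<alpha>i \<equiv> aut_inv A \<alpha>"
abbreviation \<gamma>i where "\<gamma>i \<equiv> aut_inv C \<gamma>"

text \<open>The Sweedler expressions \<open>b(c\<^sub>1, c\<^sub>2)\<close> and \<open>b(a\<^sub>\<kappa>, c\<^sup>\<kappa>)\<close>.\<close>

abbreviation sum_comult where "sum_comult P b c \<equiv> tensor_lift K C C P b (\<Delta> c)"

abbreviation sum_entwine where "sum_entwine P b c a \<equiv> tensor_lift K A C P b (\<psi> (tens K C A c a))"

lemma module_A: "module K A" and module_C: "module K C"
  by (rule alg.module_axioms coalg.module_axioms)+

lemma psi_linear: "\<psi> \<in> linear_maps K (tensor K C A) AC"
  using entwine_morphism unfolding hom_morphisms_def by blast

lemmas alphai_linear = linear_inverse[OF module_A alg.aut_linear alg.aut_bij]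
lemmas gammai_linear = linear_inverse[OF module_C coalg.aut_linear coalg.aut_bij]

lemma alpha_alphai [simp]: "a \<in> carrier A \<Longrightarrow> \<alpha> (\<alpha>i a) = a"
  and alphai_alpha [simp]: "a \<in> carrier A \<Longrightarrow> \<alpha>i (\<alpha> a) = a"
  using alg.aut_bij by (auto simp: bij_betw_def f_inv_into_f)

lemma gamma_gammai [simp]: "c \<in> carrier C \<Longrightarrow> \<gamma> (\<gamma>i c) = c"
  using coalg.aut_bij by (auto simp: bij_betw_def f_inv_into_f)

text \<open>In a Sweedler expression every variable occurs once, so at each node at most one of the following
  rules applies and applying them repeatedly decides membership in a carrier and linearity in a
  chosen variable.\<close>

lemmas module_rules = module_A module_C tensor_module

lemmas closed_rules =
  linear_closed[OF alg.aut_linear] linear_closed[OF coalg.aut_linear]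
  linear_closed[OF alphai_linear] linear_closed[OF gammai_linear]
  linear_closed[OF coalg.comult_linear] linear_closed[OF psi_linear]
  bilinear_closed[OF alg.mult_bilinear] alg.one_closed tens_closed tensor_lift_closed

lemmas linear_rules =
  linear_ident
  linear_compose[OF alg.aut_linear] linear_compose[OF coalg.aut_linear]
  linear_compose[OF alphai_linear] linear_compose[OF gammai_linear]
  linear_compose[OF coalg.comult_linear] linear_compose[OF psi_linear]
  linear_bilinear_left[OF alg.mult_bilinear] linear_bilinear_right[OF alg.mult_bilinear]
  linear_bilinear_left[OF tens_bilinear] linear_bilinear_right[OF tens_bilinear]
  linear_tensor_lift_arg linear_tensor_lift_body bilinear_mapsI
  linear_scale_functional[OF _ linear_compose[OF coalg.counit_linear]]

lemmas rules = module_rules closed_rules linear_rules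

lemmas [simp] =
  linear_closed[OF alg.aut_linear] linear_closed[OF coalg.aut_linear]
  linear_closed[OF alphai_linear] linear_closed[OF gammai_linear]
  linear_closed[OF coalg.comult_linear] bilinear_closed[OF alg.mult_bilinear] alg.one_closed

lemma counit_closed [simp]: "c \<in> carrier C \<Longrightarrow> \<epsilon> c \<in> carrier K"
  using linear_closed[OF coalg.counit_linear] by (simp add: ring_as_module_def)

text \<open>From here on the axioms of a Hom-entwining structure are restated for an arbitrary multilinear
  summand \<open>b\<close>, by applying to both sides of the axiom the linear map that \<open>b\<close> induces.\<close>

lemma entwine_one_sum:
  assumes "module K P" "b \<in> bilinear_maps K A C P" "c \<in> carrier C"
  shows "sum_entwine P b c \<one>\<^bsub>A\<^esub> = b \<one>\<^bsub>A\<^esub> c"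
  unfolding entwine_one[OF assms(3)]
  by (rule tensor_lift_tens[OF module_A module_C assms(1,2)]) (simp_all add: assms)

text \<open>This is the condition that \<open>\<psi>\<close> is a morphism of Hom-objects.\<close>

lemma entwine_aut_sum:
  assumes "module K P" and b: "b \<in> bilinear_maps K A C P" and "c \<in> carrier C" "a \<in> carrier A"
  shows "sum_entwine P b (\<gamma> c) (\<alpha> a) = sum_entwine P (\<lambda>x u. b (\<alpha> x) (\<gamma> u)) c a"
proof -
  have "tens K C A (\<gamma> c) (\<alpha> a) = tensor_map K C A C A \<gamma> \<alpha> (tens K C A c a)"
    unfolding tensor_map_def
    by (rule tensor_lift_tens[symmetric]) (assumption | rule rules assms)+
  also have "\<psi> \<dots> = tensor_map K A C A C \<alpha> \<gamma> (\<psi> (tens K C A c a))"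
    using entwine_morphism tens_closed[OF module_C module_A assms(3,4)]
    unfolding hom_morphisms_def by auto
  finally show ?thesis
    unfolding tensor_map_def
    by simp (rule linear_tensor_lift_cong tensor_lift_linear tensor_lift_tens
        | assumption | rule rules assms)+
qed

lemma entwine_mult_sum:
  assumes "module K P" and b: "b \<in> bilinear_maps K A C P"
    and "c \<in> carrier C" "a \<in> carrier A" "a' \<in> carrier A"
  shows "sum_entwine P b (\<gamma> c) (a \<otimes>\<^bsub>A\<^esub> a')
    = sum_entwine P (\<lambda>x u. sum_entwine P (\<lambda>y v. b (x \<otimes>\<^bsub>A\<^esub> y) (\<gamma> v)) u a') c a"
  unfolding entwine_mult[OF assms(4,5,3)]
  by (rule linear_tensor_lift_cong tensor_lift_linear tensor_lift_tens
      | assumption | rule rules assms)+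

lemma entwine_counit_sum:
  assumes "module K P" "f \<in> linear_maps K A P" "c \<in> carrier C" "a \<in> carrier A"
  shows "sum_entwine P (\<lambda>x u. \<epsilon> u \<odot>\<^bsub>P\<^esub> f x) c a = \<epsilon> c \<odot>\<^bsub>P\<^esub> f a"
proof -
  have "f (sum_entwine A (\<lambda>x u. \<epsilon> u \<odot>\<^bsub>A\<^esub> x) c a) = sum_entwine P (\<lambda>x u. \<epsilon> u \<odot>\<^bsub>P\<^esub> f x) c a"
    by (rule linear_tensor_lift_cong linear_smult[OF assms(2)] counit_closed linear_scale
        | assumption | rule rules assms)+
  then show ?thesis
    using assms by (simp add: entwine_counit linear_smult[OF assms(2)])
qed

lemma entwine_comult_sum:
  assumes "module K P" and b: "b \<in> trilinear_maps K A C C P"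
    and "c \<in> carrier C" "a \<in> carrier A"
  shows "sum_entwine P (\<lambda>x u. sum_comult P (b (\<alpha>i x)) u) c a
    = sum_comult P (\<lambda>c1 c2. sum_entwine P (\<lambda>x u. sum_entwine P (\<lambda>y v. b y v u) c1 x) c2 (\<alpha>i a)) c"
proof -
  let ?T = "tensor K A CC"
  obtain L where L: "L \<in> linear_maps K ?T P"
    and Lt: "\<And>x t. \<lbrakk>x \<in> carrier A; t \<in> carrier CC\<rbrakk>
      \<Longrightarrow> L (tens K A CC x t) = tensor_lift K C C P (b x) t"
    and Ltt: "\<And>x u v. \<lbrakk>x \<in> carrier A; u \<in> carrier C; v \<in> carrier C\<rbrakk>
      \<Longrightarrow> L (tens K A CC x (tens K C C u v)) = b x u v"
    using trilinear_liftE[OF module_A module_C module_C assms(1) b] by blast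
  note push = linear_tensor_lift_cong[OF _ _ _ _ L]
  have "L (sum_entwine ?T (\<lambda>x u. tens K A CC (\<alpha>i x) (\<Delta> u)) c a)
      = sum_entwine P (\<lambda>x u. sum_comult P (b (\<alpha>i x)) u) c a"
    by (rule push Lt | assumption | rule rules assms)+
  moreover have "L (sum_comult ?T (\<lambda>c1 c2. sum_entwine ?T (\<lambda>x u. sum_entwine ?T
          (\<lambda>y v. tens K A CC y (tens K C C v u)) c1 x) c2 (\<alpha>i a)) c)
      = sum_comult P (\<lambda>c1 c2. sum_entwine P (\<lambda>x u. sum_entwine P (\<lambda>y v. b y v u) c1 x) c2 (\<alpha>i a)) c"
    by (rule push Ltt | assumption | rule rules assms)+
  ultimately show ?thesis
    using entwine_comult[OF assms(4,3)] by simp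
qed

lemma coassoc_sum:
  assumes "module K P" and b: "b \<in> trilinear_maps K C C C P" and "c \<in> carrier C"
  shows "sum_comult P (\<lambda>c1 c2. sum_comult P (b (\<gamma>i c1)) c2) c
    = sum_comult P (\<lambda>c1 c2. sum_comult P (\<lambda>u v. b u v (\<gamma>i c2)) c1) c"
proof -
  let ?T = "tensor K C CC"
  obtain L where L: "L \<in> linear_maps K ?T P"
    and Lt: "\<And>x t. \<lbrakk>x \<in> carrier C; t \<in> carrier CC\<rbrakk>
      \<Longrightarrow> L (tens K C CC x t) = tensor_lift K C C P (b x) t"
    and Ltt: "\<And>x u v. \<lbrakk>x \<in> carrier C; u \<in> carrier C; v \<in> carrier C\<rbrakk>
      \<Longrightarrow> L (tens K C CC x (tens K C C u v)) = b x u v"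
    using trilinear_liftE[OF module_C module_C module_C assms(1) b] by blast
  note push = linear_tensor_lift_cong[OF _ _ _ _ L]
  have "L (sum_comult ?T (\<lambda>c1 c2. tens K C CC (\<gamma>i c1) (\<Delta> c2)) c)
      = sum_comult P (\<lambda>c1 c2. sum_comult P (b (\<gamma>i c1)) c2) c"
    by (rule push Lt | assumption | rule rules assms)+
  moreover have "L (sum_comult ?T (\<lambda>c1 c2. sum_comult ?T
          (\<lambda>u v. tens K C CC u (tens K C C v (\<gamma>i c2))) c1) c)
      = sum_comult P (\<lambda>c1 c2. sum_comult P (\<lambda>u v. b u v (\<gamma>i c2)) c1) c"
    by (rule push Ltt | assumption | rule rules assms)+
  ultimately show ?thesis
    using coalg.hom_coassoc[OF assms(3)] by simp
qed

lemma comult_aut_sum: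
  assumes "module K P" and b: "b \<in> bilinear_maps K C C P" and "c \<in> carrier C"
  shows "sum_comult P b (\<gamma> c) = sum_comult P (\<lambda>u v. b (\<gamma> u) (\<gamma> v)) c"
  unfolding coalg.comult_aut[OF assms(3)] tensor_map_def
  by (rule linear_tensor_lift_cong tensor_lift_linear tensor_lift_tens
      | assumption | rule rules assms)+

lemma
  assumes "module K P" "f \<in> linear_maps K C P" "c \<in> carrier C"
  shows counit_left_sum: "sum_comult P (\<lambda>c1 c2. \<epsilon> c1 \<odot>\<^bsub>P\<^esub> f c2) c = f (\<gamma>i c)"
    and counit_right_sum: "sum_comult P (\<lambda>c1 c2. \<epsilon> c2 \<odot>\<^bsub>P\<^esub> f c1) c = f (\<gamma>i c)"
proof -
  show "sum_comult P (\<lambda>c1 c2. \<epsilon> c1 \<odot>\<^bsub>P\<^esub> f c2) c = f (\<gamma>i c)"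
    unfolding coalg.hom_counit_left[OF assms(3), symmetric]
    by (rule linear_tensor_lift_cong[symmetric] linear_smult[OF assms(2)] counit_closed linear_scale
        | assumption | rule rules assms)+
  show "sum_comult P (\<lambda>c1 c2. \<epsilon> c2 \<odot>\<^bsub>P\<^esub> f c1) c = f (\<gamma>i c)"
    unfolding coalg.hom_counit_right[OF assms(3), symmetric]
    by (rule linear_tensor_lift_cong[symmetric] linear_smult[OF assms(2)] counit_closed linear_scale
        | assumption | rule rules assms)+
qed


section \<open>The Koppinen smash is an associative unital algebra\<close>

abbreviation H where "H \<equiv> koppinen_smash K A \<alpha> C \<gamma> \<Delta> \<epsilon> \<psi>"

abbreviation twisted where
  "twisted f g c \<equiv> sum_comult A (\<lambda>c1 c2. sum_entwine A (\<lambda>x u. x \<otimes>\<^bsub>A\<^esub> g u) c1 (f c2)) c"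

lemma koppinen_carrier: "f \<in> carrier H \<longleftrightarrow>
    f \<in> linear_maps K C A \<and> (\<forall>c\<in>carrier C. \<alpha> (f c) = f (\<gamma> c)) \<and> f \<in> extensional (carrier C)"
  by (auto simp: koppinen_smash_def hom_morphisms_def)

lemma koppinen_linear: "f \<in> carrier H \<Longrightarrow> f \<in> linear_maps K C A"
  and koppinen_aut: "\<lbrakk>f \<in> carrier H; c \<in> carrier C\<rbrakk> \<Longrightarrow> \<alpha> (f c) = f (\<gamma> c)"
  by (auto simp: koppinen_carrier)

lemma koppinen_aut_inv:
  assumes "f \<in> carrier H" "c \<in> carrier C"
  shows "\<alpha>i (f c) = f (\<gamma>i c)"
  using koppinen_aut[OF assms(1), of "\<gamma>i c"] linear_closed[OF koppinen_linear[OF assms(1)]] assms(2)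
  by (metis alphai_alpha gamma_gammai linear_closed gammai_linear)

lemma koppinen_eqI:
  assumes "f \<in> carrier H" "g \<in> carrier H" "\<And>c. c \<in> carrier C \<Longrightarrow> f c = g c"
  shows "f = g"
  using assms unfolding koppinen_carrier by (auto intro: extensionalityI)

lemma koppinen_ops:
  assumes "c \<in> carrier C"
  shows "(f \<oplus>\<^bsub>H\<^esub> g) c = f c \<oplus>\<^bsub>A\<^esub> g c" and "(r \<odot>\<^bsub>H\<^esub> f) c = r \<odot>\<^bsub>A\<^esub> f c"
    and "\<zero>\<^bsub>H\<^esub> c = \<zero>\<^bsub>A\<^esub>" and "\<one>\<^bsub>H\<^esub> c = \<epsilon> c \<odot>\<^bsub>A\<^esub> \<one>\<^bsub>A\<^esub>"
    and "(f \<otimes>\<^bsub>H\<^esub> g) c = twisted f g c"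
  using assms by (simp_all add: koppinen_smash_def)

lemma koppinen_closed:
  shows "\<lbrakk>f \<in> carrier H; g \<in> carrier H\<rbrakk> \<Longrightarrow> f \<oplus>\<^bsub>H\<^esub> g \<in> carrier H"
    and "\<lbrakk>r \<in> carrier K; f \<in> carrier H\<rbrakk> \<Longrightarrow> r \<odot>\<^bsub>H\<^esub> f \<in> carrier H"
    and "\<zero>\<^bsub>H\<^esub> \<in> carrier H" and "\<one>\<^bsub>H\<^esub> \<in> carrier H"
proof -
  note [simp] = linear_add[OF alg.aut_linear] linear_smult[OF alg.aut_linear]
  { assume f: "f \<in> carrier H" and g: "g \<in> carrier H"
    have "(\<lambda>c\<in>carrier C. f c \<oplus>\<^bsub>A\<^esub> g c) \<in> linear_maps K C A"
      by (intro linear_restrict linear_plus module_A module_C koppinen_linear f g)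
    then show "f \<oplus>\<^bsub>H\<^esub> g \<in> carrier H"
      using f g unfolding koppinen_carrier
      by (simp add: koppinen_smash_def linear_closed[OF koppinen_linear[OF f]]
          linear_closed[OF koppinen_linear[OF g]]) }
  { assume r: "r \<in> carrier K" and f: "f \<in> carrier H"
    have "(\<lambda>c\<in>carrier C. r \<odot>\<^bsub>A\<^esub> f c) \<in> linear_maps K C A"
      by (intro linear_restrict linear_scale module_A module_C koppinen_linear f r)
    then show "r \<odot>\<^bsub>H\<^esub> f \<in> carrier H"
      using f unfolding koppinen_carrier
      by (simp add: koppinen_smash_def linear_closed[OF koppinen_linear[OF f]] r) }
  have "(\<lambda>c\<in>carrier C. \<zero>\<^bsub>A\<^esub>) \<in> linear_maps K C A"
    by (rule linear_restrict[OF module_C linear_mapsI]) auto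
  then show "\<zero>\<^bsub>H\<^esub> \<in> carrier H"
    unfolding koppinen_carrier
    by (simp add: koppinen_smash_def linear_zero[OF module_A module_A alg.aut_linear])
  have "(\<lambda>c\<in>carrier C. \<epsilon> c \<odot>\<^bsub>A\<^esub> \<one>\<^bsub>A\<^esub>) \<in> linear_maps K C A"
    by (intro linear_restrict linear_scale_functional module_A module_C coalg.counit_linear alg.one_closed)
  then show "\<one>\<^bsub>H\<^esub> \<in> carrier H"
    unfolding koppinen_carrier
    by (simp add: koppinen_smash_def alg.aut_one coalg.counit_aut)
qed

lemma koppinen_module: "module K H"
proof -
  note cl = koppinen_closed
  have pt: "f c \<in> carrier A" if "f \<in> carrier H" "c \<in> carrier C" for f c
    using linear_closed[OF koppinen_linear] that .
  note [simp] = koppinen_ops pt cl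
  show ?thesis
  proof (rule moduleI)
    show "abelian_group H"
    proof (rule abelian_groupI)
      fix f assume f: "f \<in> carrier H"
      have "((\<ominus>\<^bsub>K\<^esub> \<one>\<^bsub>K\<^esub>) \<odot>\<^bsub>H\<^esub> f) \<oplus>\<^bsub>H\<^esub> f = \<zero>\<^bsub>H\<^esub>"
        by (rule koppinen_eqI) (use f in \<open>simp_all add: alg.smult_l_minus alg.M.l_neg\<close>)
      with f show "\<exists>g\<in>carrier H. g \<oplus>\<^bsub>H\<^esub> f = \<zero>\<^bsub>H\<^esub>"
        by (meson cl(2) alg.R.a_inv_closed alg.R.one_closed)
    qed (auto intro!: koppinen_eqI simp: alg.M.a_ac)
  qed (auto intro!: koppinen_eqI simp: alg.R.is_cring alg.smult_l_distr alg.smult_r_distr alg.smult_assoc1)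
qed

lemma koppinen_eval_linear: "c \<in> carrier C \<Longrightarrow> (\<lambda>f. f c) \<in> linear_maps K H A"
  by (rule linear_mapsI) (simp_all add: koppinen_ops linear_closed[OF koppinen_linear])

context
  fixes f g
  assumes f: "f \<in> linear_maps K C A" and g: "g \<in> linear_maps K C A"
begin

lemma twisted_inner_bilinear:
  "(\<lambda>x u. x \<otimes>\<^bsub>A\<^esub> g u) \<in> bilinear_maps K A C A"
  by (assumption | rule rules linear_compose[OF g] linear_closed[OF g])+

lemma twisted_outer_bilinear:
  "(\<lambda>c1 c2. sum_entwine A (\<lambda>x u. x \<otimes>\<^bsub>A\<^esub> g u) c1 (f c2)) \<in> bilinear_maps K C C A"
  by (assumption | rule rules linear_compose[OF f] linear_closed[OF f]
      linear_compose[OF g] linear_closed[OF g])+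

lemma twisted_linear: "(\<lambda>c. twisted f g c) \<in> linear_maps K C A"
  by (rule linear_tensor_lift_arg[OF _ _ _ twisted_outer_bilinear]
      | rule module_rules coalg.comult_linear)+

end

text \<open>\<open>f * g\<close> commutes with the automorphisms since \<open>\<alpha>\<close> is multiplicative and \<open>\<psi>\<close> and \<open>\<Delta>\<close> commute with
  them.\<close>

lemma koppinen_mult_closed:
  assumes f: "f \<in> carrier H" and g: "g \<in> carrier H"
  shows "f \<otimes>\<^bsub>H\<^esub> g \<in> carrier H"
proof -
  note fl = koppinen_linear[OF f] and gl = koppinen_linear[OF g]
  note r = rules linear_compose[OF fl] linear_closed[OF fl] linear_compose[OF gl] linear_closed[OF gl]
  have "\<alpha> (twisted f g c) = twisted f g (\<gamma> c)" if c: "c \<in> carrier C" for c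
  proof -
    have "\<alpha> (x \<otimes>\<^bsub>A\<^esub> g u) = \<alpha> x \<otimes>\<^bsub>A\<^esub> g (\<gamma> u)" if "x \<in> carrier A" "u \<in> carrier C" for x u
      using that by (simp add: alg.aut_mult koppinen_aut[OF g] linear_closed[OF gl])
    note push = linear_tensor_lift_cong[OF _ _ _ _ alg.aut_linear] this
    have "\<alpha> (twisted f g c) = sum_comult A (\<lambda>c1 c2. sum_entwine A (\<lambda>x u. \<alpha> x \<otimes>\<^bsub>A\<^esub> g (\<gamma> u)) c1 (f c2)) c"
      by (rule push | assumption | rule r c)+
    also have "\<dots> = sum_comult A (\<lambda>c1 c2. sum_entwine A (\<lambda>x u. x \<otimes>\<^bsub>A\<^esub> g u) (\<gamma> c1) (f (\<gamma> c2))) c"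
    proof (rule tensor_lift_cong)
      fix c1 c2 assume c12: "c1 \<in> carrier C" "c2 \<in> carrier C"
      show "sum_entwine A (\<lambda>x u. \<alpha> x \<otimes>\<^bsub>A\<^esub> g (\<gamma> u)) c1 (f c2)
          = sum_entwine A (\<lambda>x u. x \<otimes>\<^bsub>A\<^esub> g u) (\<gamma> c1) (f (\<gamma> c2))"
        unfolding koppinen_aut[OF f c12(2), symmetric]
        by (rule entwine_aut_sum[symmetric] | assumption | rule r c12)+
    qed (assumption | rule r c)+
    also have "\<dots> = twisted f g (\<gamma> c)"
      by (rule comult_aut_sum[symmetric, OF module_A twisted_outer_bilinear[OF fl gl] c])
    finally show ?thesis .
  qed
  moreover have "restrict (twisted f g) (carrier C) \<in> linear_maps K C A"
    by (rule linear_restrict[OF module_C twisted_linear[OF fl gl]])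
  ultimately show ?thesis
    unfolding koppinen_carrier by (simp add: koppinen_smash_def)
qed

text \<open>\<open>\<psi>(c \<otimes> 1) = 1 \<otimes> c\<close> reduces the product to \<open>\<epsilon>(c\<^sub>2) 1 f(c\<^sub>1) = \<alpha>(f(\<gamma>\<^sup>-\<^sup>1(c)))\<close>.\<close>

lemma koppinen_one_left:
  assumes f: "f \<in> carrier H"
  shows "\<one>\<^bsub>H\<^esub> \<otimes>\<^bsub>H\<^esub> f = f"
proof (rule koppinen_eqI[OF koppinen_mult_closed[OF koppinen_closed(4) f] f])
  fix c assume c: "c \<in> carrier C"
  note fl = koppinen_linear[OF f]
  note r = rules linear_compose[OF fl] linear_closed[OF fl]
  have "twisted \<one>\<^bsub>H\<^esub> f c = sum_comult A (\<lambda>c1 c2. \<epsilon> c2 \<odot>\<^bsub>A\<^esub> \<alpha> (f c1)) c"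
  proof (rule tensor_lift_cong[OF module_C module_C module_A _
        twisted_outer_bilinear[OF koppinen_linear[OF koppinen_closed(4)] fl]])
    fix c1 c2 assume c12: "c1 \<in> carrier C" "c2 \<in> carrier C"
    have L: "(\<lambda>a. sum_entwine A (\<lambda>x u. x \<otimes>\<^bsub>A\<^esub> f u) c1 a) \<in> linear_maps K A A"
      by (assumption | rule r c12)+
    have "sum_entwine A (\<lambda>x u. x \<otimes>\<^bsub>A\<^esub> f u) c1 (\<one>\<^bsub>H\<^esub> c2)
        = \<epsilon> c2 \<odot>\<^bsub>A\<^esub> sum_entwine A (\<lambda>x u. x \<otimes>\<^bsub>A\<^esub> f u) c1 \<one>\<^bsub>A\<^esub>"
      using linear_smult[OF L counit_closed[OF c12(2)] alg.one_closed] c12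
      by (simp add: koppinen_ops)
    also have "sum_entwine A (\<lambda>x u. x \<otimes>\<^bsub>A\<^esub> f u) c1 \<one>\<^bsub>A\<^esub> = \<one>\<^bsub>A\<^esub> \<otimes>\<^bsub>A\<^esub> f c1"
      by (rule entwine_one_sum | assumption | rule r c12)+
    finally show "sum_entwine A (\<lambda>x u. x \<otimes>\<^bsub>A\<^esub> f u) c1 (\<one>\<^bsub>H\<^esub> c2) = \<epsilon> c2 \<odot>\<^bsub>A\<^esub> \<alpha> (f c1)"
      using c12 by (simp add: alg.hom_unit_left linear_closed[OF fl])
  qed (rule r c)+
  also have "\<dots> = \<alpha> (f (\<gamma>i c))"
    by (rule counit_right_sum | assumption | rule r c)+
  also have "\<dots> = f c"
    using c by (simp add: koppinen_aut[OF f])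
  finally show "(\<one>\<^bsub>H\<^esub> \<otimes>\<^bsub>H\<^esub> f) c = f c"
    using c by (simp add: koppinen_ops)
qed

text \<open>The counit condition on \<open>\<psi>\<close> reduces the product to \<open>\<epsilon>(c\<^sub>1) f(c\<^sub>2) 1 = \<alpha>(f(\<gamma>\<^sup>-\<^sup>1(c)))\<close>.\<close>

lemma koppinen_one_right:
  assumes f: "f \<in> carrier H"
  shows "f \<otimes>\<^bsub>H\<^esub> \<one>\<^bsub>H\<^esub> = f"
proof (rule koppinen_eqI[OF koppinen_mult_closed[OF f koppinen_closed(4)] f])
  fix c assume c: "c \<in> carrier C"
  note fl = koppinen_linear[OF f] and ol = koppinen_linear[OF koppinen_closed(4)]
  note r = rules linear_compose[OF fl] linear_closed[OF fl]
  have "twisted f \<one>\<^bsub>H\<^esub> c = sum_comult A (\<lambda>c1 c2. \<epsilon> c1 \<odot>\<^bsub>A\<^esub> \<alpha> (f c2)) c"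
  proof (rule tensor_lift_cong[OF module_C module_C module_A _ twisted_outer_bilinear[OF fl ol]])
    fix c1 c2 assume c12: "c1 \<in> carrier C" "c2 \<in> carrier C"
    have "sum_entwine A (\<lambda>x u. x \<otimes>\<^bsub>A\<^esub> \<one>\<^bsub>H\<^esub> u) c1 (f c2) = sum_entwine A (\<lambda>x u. \<epsilon> u \<odot>\<^bsub>A\<^esub> \<alpha> x) c1 (f c2)"
    proof (rule tensor_lift_cong[OF module_A module_C module_A _ twisted_inner_bilinear[OF fl ol]])
      fix x u assume xu: "x \<in> carrier A" "u \<in> carrier C"
      show "x \<otimes>\<^bsub>A\<^esub> \<one>\<^bsub>H\<^esub> u = \<epsilon> u \<odot>\<^bsub>A\<^esub> \<alpha> x"
        using xu by (simp add: koppinen_ops alg.hom_unit_right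
            linear_smult[OF bilinear_right[OF alg.mult_bilinear]])
    qed (rule r c12)+
    also have "\<dots> = \<epsilon> c1 \<odot>\<^bsub>A\<^esub> \<alpha> (f c2)"
      by (rule entwine_counit_sum[OF module_A alg.aut_linear] | rule r c12)+
    finally show "sum_entwine A (\<lambda>x u. x \<otimes>\<^bsub>A\<^esub> \<one>\<^bsub>H\<^esub> u) c1 (f c2) = \<epsilon> c1 \<odot>\<^bsub>A\<^esub> \<alpha> (f c2)" .
  qed (rule r c)+
  also have "\<dots> = \<alpha> (f (\<gamma>i c))"
    by (rule counit_left_sum | assumption | rule r c)+
  also have "\<dots> = f c"
    using c by (simp add: koppinen_aut[OF f])
  finally show "(f \<otimes>\<^bsub>H\<^esub> \<one>\<^bsub>H\<^esub>) c = f c"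
    using c by (simp add: koppinen_ops)
qed

text \<open>In the proof \<open>G x y z\<close> is \<open>(f(z)\<^sub>\<lambda>\<^sub>\<kappa> g(y\<^sup>\<lambda>)\<^sub>\<mu>) h(\<gamma>(x\<^sup>\<kappa>\<^sup>\<mu>))\<close>, and \<open>B\<close> is its part after the first two
  applications of \<open>\<psi>\<close>.\<close>

lemma koppinen_assoc:
  assumes f: "f \<in> carrier H" and g: "g \<in> carrier H" and h: "h \<in> carrier H"
  shows "(f \<otimes>\<^bsub>H\<^esub> g) \<otimes>\<^bsub>H\<^esub> h = f \<otimes>\<^bsub>H\<^esub> (g \<otimes>\<^bsub>H\<^esub> h)"
proof (rule koppinen_eqI)
  show "(f \<otimes>\<^bsub>H\<^esub> g) \<otimes>\<^bsub>H\<^esub> h \<in> carrier H" "f \<otimes>\<^bsub>H\<^esub> (g \<otimes>\<^bsub>H\<^esub> h) \<in> carrier H"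
    by (intro koppinen_mult_closed f g h)+
  fix c assume c: "c \<in> carrier C"
  note fl = koppinen_linear[OF f] and gl = koppinen_linear[OF g] and hl = koppinen_linear[OF h]
    and fgl = koppinen_linear[OF koppinen_mult_closed[OF f g]]
    and ghl = koppinen_linear[OF koppinen_mult_closed[OF g h]]
  note r = rules linear_compose[OF fl] linear_closed[OF fl] linear_compose[OF gl] linear_closed[OF gl]
    linear_compose[OF hl] linear_closed[OF hl]
  define B where "B = (\<lambda>p w u. sum_entwine A (\<lambda>q v. (p \<otimes>\<^bsub>A\<^esub> q) \<otimes>\<^bsub>A\<^esub> h (\<gamma> v)) w (g u))"
  define G where "G = (\<lambda>x y z. sum_entwine A (\<lambda>a u. sum_entwine A (\<lambda>p w. B p w u) x a) y (f z))"
  have B: "B \<in> trilinear_maps K A C C A"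
    unfolding B_def by (rule trilinear_mapsI; (assumption | rule r)+)
  have G: "G \<in> trilinear_maps K C C C A"
    unfolding G_def B_def by (rule trilinear_mapsI; (assumption | rule r)+)
  have "twisted (f \<otimes>\<^bsub>H\<^esub> g) h c = sum_comult A (\<lambda>c1 c2. sum_comult A (G (\<gamma>i c1)) c2) c"
  proof (rule tensor_lift_cong[OF module_C module_C module_A _ twisted_outer_bilinear[OF fgl hl]])
    fix c1 c2 assume c12: "c1 \<in> carrier C" "c2 \<in> carrier C"
    have Llin: "(\<lambda>a. sum_entwine A (\<lambda>x u. x \<otimes>\<^bsub>A\<^esub> h u) c1 a) \<in> linear_maps K A A"
      by (assumption | rule r c12)+
    define L where "L = (\<lambda>a. sum_entwine A (\<lambda>x u. x \<otimes>\<^bsub>A\<^esub> h u) c1 a)"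
    note L = Llin[folded L_def]
    \<comment> \<open>The first argument of \<open>\<psi>\<close> must have the form \<open>\<gamma>(d)\<close>; this is where \<open>\<gamma>\<^sup>-\<^sup>1(c\<^sub>1)\<close> comes from.\<close>
    have mult: "L (a \<otimes>\<^bsub>A\<^esub> g u) = sum_entwine A (\<lambda>p w. B p w u) (\<gamma>i c1) a"
      if au: "a \<in> carrier A" "u \<in> carrier C" for a u
    proof -
      have "L (a \<otimes>\<^bsub>A\<^esub> g u) = sum_entwine A (\<lambda>x u. x \<otimes>\<^bsub>A\<^esub> h u) (\<gamma> (\<gamma>i c1)) (a \<otimes>\<^bsub>A\<^esub> g u)"
        using c12 by (simp add: L_def)
      also have "\<dots> = sum_entwine A (\<lambda>p w. B p w u) (\<gamma>i c1) a"
        unfolding B_def by (rule entwine_mult_sum | assumption | rule r c12 au)+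
      finally show ?thesis .
    qed
    have "L (twisted f g c2) = sum_comult A (G (\<gamma>i c1)) c2"
      unfolding G_def
      by (rule linear_tensor_lift_cong[OF _ _ _ _ L] mult | assumption | rule r c12)+
    then show "sum_entwine A (\<lambda>x u. x \<otimes>\<^bsub>A\<^esub> h u) c1 ((f \<otimes>\<^bsub>H\<^esub> g) c2) = sum_comult A (G (\<gamma>i c1)) c2"
      using c12 by (simp add: koppinen_ops L_def)
  qed (rule r c)+
  also have "\<dots> = sum_comult A (\<lambda>c1 c2. sum_comult A (\<lambda>u v. G u v (\<gamma>i c2)) c1) c"
    by (rule coassoc_sum[OF module_A G c])
  also have "\<dots> = twisted f (g \<otimes>\<^bsub>H\<^esub> h) c"
  proof (rule tensor_lift_cong[symmetric, OF module_C module_C module_A _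
        twisted_outer_bilinear[OF fl ghl]])
    fix c1 c2 assume c12: "c1 \<in> carrier C" "c2 \<in> carrier C"
    \<comment> \<open>Writing \<open>x = \<alpha>(\<alpha>\<^sup>-\<^sup>1(x))\<close> produces the \<open>\<alpha>\<^sup>-\<^sup>1(a\<^sub>\<kappa>)\<close> that compatibility with \<open>\<Delta>\<close> requires.\<close>
    have assoc: "x \<otimes>\<^bsub>A\<^esub> (q \<otimes>\<^bsub>A\<^esub> h v) = (\<alpha>i x \<otimes>\<^bsub>A\<^esub> q) \<otimes>\<^bsub>A\<^esub> h (\<gamma> v)"
      if "x \<in> carrier A" "q \<in> carrier A" "v \<in> carrier C" for x q v
      using alg.hom_assoc[of "\<alpha>i x" q "h v"] that
      by (simp add: linear_closed[OF hl] koppinen_aut[OF h])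
    have "sum_entwine A (\<lambda>x u. x \<otimes>\<^bsub>A\<^esub> (g \<otimes>\<^bsub>H\<^esub> h) u) c1 (f c2)
        = sum_entwine A (\<lambda>x u. sum_comult A (B (\<alpha>i x)) u) c1 (f c2)"
    proof (rule tensor_lift_cong[OF module_A module_C module_A _ twisted_inner_bilinear[OF fl ghl]])
      fix x u assume xu: "x \<in> carrier A" "u \<in> carrier C"
      note mx = bilinear_right[OF alg.mult_bilinear xu(1)]
      have "x \<otimes>\<^bsub>A\<^esub> twisted g h u = sum_comult A (B (\<alpha>i x)) u"
        unfolding B_def
        by (rule linear_tensor_lift_cong[OF _ _ _ _ mx] assoc | assumption | rule r xu)+
      then show "x \<otimes>\<^bsub>A\<^esub> (g \<otimes>\<^bsub>H\<^esub> h) u = sum_comult A (B (\<alpha>i x)) u"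
        using xu by (simp add: koppinen_ops)
    qed (rule r c12)+
    also have "\<dots> = sum_comult A (\<lambda>u v. G u v (\<gamma>i c2)) c1"
      unfolding entwine_comult_sum[OF module_A B c12(1) linear_closed[OF fl c12(2)]]
        koppinen_aut_inv[OF f c12(2)] G_def ..
    finally show "sum_entwine A (\<lambda>x u. x \<otimes>\<^bsub>A\<^esub> (g \<otimes>\<^bsub>H\<^esub> h) u) c1 (f c2)
      = sum_comult A (\<lambda>u v. G u v (\<gamma>i c2)) c1" .
  qed (rule r c)+
  finally show "((f \<otimes>\<^bsub>H\<^esub> g) \<otimes>\<^bsub>H\<^esub> h) c = (f \<otimes>\<^bsub>H\<^esub> (g \<otimes>\<^bsub>H\<^esub> h)) c"
    using c by (simp add: koppinen_ops)
qed

lemma twisted_linear_left: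
  assumes g: "g \<in> carrier H" and c: "c \<in> carrier C"
  shows "(\<lambda>f. twisted f g c) \<in> linear_maps K H A"
proof -
  note gl = koppinen_linear[OF g]
  show ?thesis
    by (rule linear_tensor_lift_body[OF koppinen_module] twisted_outer_bilinear[OF koppinen_linear gl]
        koppinen_eval_linear | assumption
        | rule rules c linear_compose[OF gl] linear_closed[OF gl])+
qed

lemma twisted_linear_right:
  assumes f: "f \<in> carrier H" and c: "c \<in> carrier C"
  shows "(\<lambda>g. twisted f g c) \<in> linear_maps K H A"
proof -
  note fl = koppinen_linear[OF f]
  show ?thesis
    by (rule linear_tensor_lift_body[OF koppinen_module] twisted_outer_bilinear[OF fl koppinen_linear]
        twisted_inner_bilinear[OF fl koppinen_linear]
        koppinen_eval_linear | assumption
        | rule rules c linear_compose[OF fl] linear_closed[OF fl])+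
qed

lemma koppinen_mult_bilinear: "mult H \<in> bilinear_maps K H H H"
proof -
  note cl = koppinen_closed koppinen_mult_closed
  have "(\<lambda>f g. f \<otimes>\<^bsub>H\<^esub> g) \<in> bilinear_maps K H H H"
    by (intro bilinear_mapsI linear_mapsI cl; (assumption)?; rule koppinen_eqI)
      (simp_all add: cl koppinen_ops linear_add[OF twisted_linear_left] linear_add[OF twisted_linear_right]
        linear_smult[OF twisted_linear_left] linear_smult[OF twisted_linear_right])
  then show ?thesis by simp
qed

lemma koppinen_algebra: "assoc_unital_algebra K H"
proof -
  have "ring H"
  proof (rule ringI)
    show "abelian_group H" by (rule module.axioms(2)[OF koppinen_module])
    show "monoid H"
      by (rule monoidI)
        (simp_all add: koppinen_closed koppinen_mult_closed koppinen_assoc koppinen_one_left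
          koppinen_one_right)
  qed (simp_all add: linear_add[OF bilinear_left[OF koppinen_mult_bilinear]]
      linear_add[OF bilinear_right[OF koppinen_mult_bilinear]])
  then show ?thesis
    unfolding assoc_unital_algebra_def using koppinen_module koppinen_mult_bilinear by blast
qed

end


section \<open>Tensor products over a Hom-algebra\<close>

locale tensor_over_data =
  fixes K :: "'k ring" and A :: "('k, 'a) module"
    and M :: "('k, 'm) module" and \<mu> :: "'m \<Rightarrow> 'm" and ract :: "'m \<Rightarrow> 'a \<Rightarrow> 'm"
    and N :: "('k, 'n) module" and \<nu> :: "'n \<Rightarrow> 'n" and lact :: "'a \<Rightarrow> 'n \<Rightarrow> 'n"
  assumes module_M: "module K M" and module_N: "module K N"
    and ract_closed: "\<And>m a. \<lbrakk>m \<in> carrier M; a \<in> carrier A\<rbrakk> \<Longrightarrow> ract m a \<in> carrier M"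
    and lact_closed: "\<And>a n. \<lbrakk>a \<in> carrier A; n \<in> carrier N\<rbrakk> \<Longrightarrow> lact a n \<in> carrier N"
    and aut_closed: "\<And>m. m \<in> carrier M \<Longrightarrow> \<mu> m \<in> carrier M"
    and aut_inv_closed: "\<And>n. n \<in> carrier N \<Longrightarrow> aut_inv N \<nu> n \<in> carrier N"
begin

abbreviation rels where "rels \<equiv>
  {tens K M N (ract m a) n \<ominus>\<^bsub>tensor K M N\<^esub> tens K M N (\<mu> m) (lact a (aut_inv N \<nu> n)) | m a n.
     m \<in> carrier M \<and> a \<in> carrier A \<and> n \<in> carrier N}"

lemma rels_subset: "rels \<subseteq> carrier (tensor K M N)"
proof -
  interpret T: module K "tensor K M N" by (rule tensor_module[OF module_M module_N])
  show ?thesis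
    by (auto intro!: T.minus_closed tens_closed module_M module_N ract_closed aut_closed lact_closed
        aut_inv_closed)
qed

sublocale Q: quotient_module K "tensor K M N" "tensor_over_null K A M \<mu> ract N \<nu> lact"
  unfolding tensor_over_null_def
  by (rule quotient_module.intro[OF tensor_module[OF module_M module_N]
        submodule_span_submodule[OF tensor_module[OF module_M module_N] rels_subset]])

lemma tensor_over_module: "module K (tensor_over K A M \<mu> ract N \<nu> lact)"
  unfolding tensor_over_def by (rule Q.quot_module)

lemma tens_over_bilinear: "tens_over K A M \<mu> ract N \<nu> lact
    \<in> bilinear_maps K M N (tensor_over K A M \<mu> ract N \<nu> lact)"
proof -
  have "(\<lambda>m n. tens_over K A M \<mu> ract N \<nu> lact m n)
      \<in> bilinear_maps K M N (tensor_over K A M \<mu> ract N \<nu> lact)"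
    unfolding tens_over_def tensor_over_def
    by (intro bilinear_mapsI linear_compose[OF Q.coset_linear]
        bilinear_left[OF tens_bilinear[OF module_M module_N]]
        bilinear_right[OF tens_bilinear[OF module_M module_N]])
  then show ?thesis by simp
qed

lemma
  assumes P: "module K P" and b: "b \<in> bilinear_maps K M N P"
    and balanced: "\<And>m a n. \<lbrakk>m \<in> carrier M; a \<in> carrier A; n \<in> carrier N\<rbrakk>
      \<Longrightarrow> b (ract m a) n = b (\<mu> m) (lact a (aut_inv N \<nu> n))"
  shows tensor_over_lift_linear: "tensor_over_lift K M N P b
      \<in> linear_maps K (tensor_over K A M \<mu> ract N \<nu> lact) P"
    and tensor_over_lift_tens: "\<lbrakk>m \<in> carrier M; n \<in> carrier N\<rbrakk>
      \<Longrightarrow> tensor_over_lift K M N P b (tens_over K A M \<mu> ract N \<nu> lact m n) = b m n"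
proof -
  note lin = tensor_lift_linear[OF module_M module_N P b]
    and eval = tensor_lift_tens[OF module_M module_N P b]
  interpret P: module K P by fact
  have "tensor_lift K M N P b s = \<zero>\<^bsub>P\<^esub>" if "s \<in> rels" for s
  proof -
    from that obtain m a n where *: "m \<in> carrier M" "a \<in> carrier A" "n \<in> carrier N" and
      s: "s = tens K M N (ract m a) n \<ominus>\<^bsub>tensor K M N\<^esub> tens K M N (\<mu> m) (lact a (aut_inv N \<nu> n))"
      by blast
    have "tensor_lift K M N P b s = b (ract m a) n \<ominus>\<^bsub>P\<^esub> b (\<mu> m) (lact a (aut_inv N \<nu> n))"
      unfolding s
      by (simp add: * linear_diff[OF Q.mod P lin] eval tens_closed module_M module_N
          ract_closed aut_closed lact_closed aut_inv_closed)
    also have "\<dots> = \<zero>\<^bsub>P\<^esub>"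
      using bilinear_closed[OF b ract_closed[OF *(1,2)] *(3)]
      by (simp add: balanced[OF *, symmetric] a_minus_def P.r_neg)
    finally show ?thesis .
  qed
  then have null: "tensor_lift K M N P b t = \<zero>\<^bsub>P\<^esub>"
    if "t \<in> tensor_over_null K A M \<mu> ract N \<nu> lact" for t
    using linear_zero_on_span[OF Q.mod P lin rels_subset _ that[unfolded tensor_over_null_def]]
    by blast
  show "tensor_over_lift K M N P b \<in> linear_maps K (tensor_over K A M \<mu> ract N \<nu> lact) P"
    using Q.lift_linear[OF P lin null] unfolding tensor_over_lift_def tensor_over_def .
  show "tensor_over_lift K M N P b (tens_over K A M \<mu> ract N \<nu> lact m n) = b m n"
    if "m \<in> carrier M" "n \<in> carrier N"
    unfolding tensor_over_lift_def tens_over_def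
    using Q.lift_coset[OF P lin null tens_closed[OF module_M module_N that]] eval[OF that] by simp
qed

end


section \<open>Transport of an algebra structure along an anti-isomorphism\<close>

text \<open>The axioms of a ring, and of an algebra over a commutative ring, are invariant under reversing
  the product.\<close>

lemma assoc_unital_algebra_anti_transport:
  assumes B: "assoc_unital_algebra K B" and bij: "bij_betw \<Phi> (carrier B) (carrier D)"
    and zero: "\<Phi> \<zero>\<^bsub>B\<^esub> = \<zero>\<^bsub>D\<^esub>" and one: "\<Phi> \<one>\<^bsub>B\<^esub> = \<one>\<^bsub>D\<^esub>"
    and add: "\<And>x y. \<lbrakk>x \<in> carrier B; y \<in> carrier B\<rbrakk> \<Longrightarrow> \<Phi> (x \<oplus>\<^bsub>B\<^esub> y) = \<Phi> x \<oplus>\<^bsub>D\<^esub> \<Phi> y"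
    and smult: "\<And>r x. \<lbrakk>r \<in> carrier K; x \<in> carrier B\<rbrakk> \<Longrightarrow> \<Phi> (r \<odot>\<^bsub>B\<^esub> x) = r \<odot>\<^bsub>D\<^esub> \<Phi> x"
    and mult: "\<And>x y. \<lbrakk>x \<in> carrier B; y \<in> carrier B\<rbrakk> \<Longrightarrow> \<Phi> (x \<otimes>\<^bsub>B\<^esub> y) = \<Phi> y \<otimes>\<^bsub>D\<^esub> \<Phi> x"
  shows "assoc_unital_algebra K D" and "\<Phi> \<in> algebra_anti_iso K B D"
proof -
  interpret M: module K B using B by (simp add: assoc_unital_algebra_def)
  interpret R: ring B using B by (simp add: assoc_unital_algebra_def)
  have bil: "mult B \<in> bilinear_maps K B B B" using B by (simp add: assoc_unital_algebra_def)
  note ml = linear_smult[OF bilinear_left[OF bil]] and mr = linear_smult[OF bilinear_right[OF bil]]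
  have cl: "\<Phi> x \<in> carrier D" if "x \<in> carrier B" for x
    using bij that by (auto simp: bij_betw_def)
  show "\<Phi> \<in> algebra_anti_iso K B D"
    unfolding algebra_anti_iso_def
    using bij one mult by (auto intro!: linear_mapsI cl add smult)
  have im: "\<exists>x\<in>carrier B. z = \<Phi> x" if "z \<in> carrier D" for z
    using bij that by (auto simp: bij_betw_def)
  note simps = cl zero[symmetric] one[symmetric] add[symmetric] smult[symmetric] mult[symmetric]
  have grp: "abelian_group D"
  proof (rule abelian_groupI)
    fix z assume "z \<in> carrier D"
    then obtain x where x: "x \<in> carrier B" "z = \<Phi> x" using im by blast
    then show "\<exists>y\<in>carrier D. y \<oplus>\<^bsub>D\<^esub> z = \<zero>\<^bsub>D\<^esub>"
      by (intro bexI[of _ "\<Phi> (\<ominus>\<^bsub>B\<^esub> x)"]) (simp_all add: simps M.M.l_neg)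
  qed (auto dest!: im simp: simps M.M.a_ac)
  have mod: "module K D"
    by (rule moduleI[OF M.R.is_cring grp])
      (auto dest!: im simp: simps M.smult_l_distr M.smult_r_distr M.smult_assoc1)
  have mon: "monoid D"
    by (rule monoidI) (auto dest!: im simp: simps R.m_assoc)
  have rng: "ring D"
    by (rule ringI[OF grp mon]) (auto dest!: im simp: simps R.l_distr R.r_distr)
  have "(\<lambda>x y. x \<otimes>\<^bsub>D\<^esub> y) \<in> bilinear_maps K D D D"
    by (intro bilinear_mapsI linear_mapsI)
      (auto dest!: im simp: simps R.l_distr R.r_distr ml mr)
  with mod rng show "assoc_unital_algebra K D"
    by (simp add: assoc_unital_algebra_def)
qed


section \<open>The Hom-coring and its left dual\<close>

context hom_entwining
begin

abbreviation \<chi> where "\<chi> \<equiv> coring_aut K A \<alpha> C \<gamma>"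
abbreviation lact where "lact \<equiv> coring_lact K A \<alpha> C \<gamma>"
abbreviation ract where "ract \<equiv> coring_ract K A \<alpha> C \<gamma> \<psi>"
abbreviation D where "D \<equiv> left_dual_algebra K A \<alpha> C \<gamma> \<Delta> \<epsilon> \<psi>"

lemma module_AC: "module K AC"
  by (rule module_rules)+

lemma chi_linear: "\<chi> \<in> linear_maps K AC AC"
  and chi_tens: "\<lbrakk>a \<in> carrier A; c \<in> carrier C\<rbrakk> \<Longrightarrow> \<chi> (tens K A C a c) = tens K A C (\<alpha> a) (\<gamma> c)"
  unfolding coring_aut_def tensor_map_def
  by (rule tensor_lift_linear tensor_lift_tens | assumption | rule rules)+

lemma lact_linear: "a \<in> carrier A \<Longrightarrow> lact a \<in> linear_maps K AC AC"
  and lact_tens: "\<lbrakk>a \<in> carrier A; a' \<in> carrier A; c \<in> carrier C\<rbrakk>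
    \<Longrightarrow> lact a (tens K A C a' c) = tens K A C (\<alpha>i a \<otimes>\<^bsub>A\<^esub> a') (\<gamma> c)"
  unfolding coring_lact_def
  by (rule tensor_lift_linear tensor_lift_tens | assumption | rule rules)+

lemma ract_bilinear: "ract \<in> bilinear_maps K AC A AC"
proof -
  have "(\<lambda>x a. ract x a) \<in> bilinear_maps K AC A AC"
    unfolding coring_ract_def by (assumption | rule rules)+
  then show ?thesis by simp
qed

lemma ract_tens: "\<lbrakk>a \<in> carrier A; a' \<in> carrier A; c \<in> carrier C\<rbrakk>
    \<Longrightarrow> ract (tens K A C a' c) a = sum_entwine AC (\<lambda>x u. tens K A C (a' \<otimes>\<^bsub>A\<^esub> x) (\<gamma> u)) c (\<alpha>i a)"
  unfolding coring_ract_def by (rule tensor_lift_tens | assumption | rule rules)+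

text \<open>\<open>\<chi> = \<alpha> \<otimes> \<gamma>\<close> is surjective, having the right inverse \<open>\<alpha>\<^sup>-\<^sup>1 \<otimes> \<gamma>\<^sup>-\<^sup>1\<close>; the \<open>A\<close>-balancing relations are
  written with the inverse of \<open>\<chi>\<close>.\<close>

lemma chi_inv_closed: "x \<in> carrier AC \<Longrightarrow> aut_inv AC \<chi> x \<in> carrier AC"
  and chi_chi_inv: "x \<in> carrier AC \<Longrightarrow> \<chi> (aut_inv AC \<chi> x) = x"
proof -
  assume x: "x \<in> carrier AC"
  let ?inv = "tensor_lift K A C AC (\<lambda>a c. tens K A C (\<alpha>i a) (\<gamma>i c))"
  have inv: "?inv \<in> linear_maps K AC AC"
    by (rule tensor_lift_linear | assumption | rule rules)+
  have inv_tens: "?inv (tens K A C a c) = tens K A C (\<alpha>i a) (\<gamma>i c)"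
    if "a \<in> carrier A" "c \<in> carrier C" for a c
    by (rule tensor_lift_tens | assumption | rule rules that)+
  have "x = \<chi> (?inv x)"
    by (rule tensor_linear_eqI[OF module_A module_C module_AC linear_ident
          linear_compose[OF chi_linear inv] _ x]) (simp add: inv_tens chi_tens)
  then have "x \<in> \<chi> ` carrier AC"
    by (rule image_eqI) (rule linear_closed[OF inv x])
  then show "aut_inv AC \<chi> x \<in> carrier AC" "\<chi> (aut_inv AC \<chi> x) = x"
    by (rule inv_into_into f_inv_into_f)+
qed

text \<open>The Hom-module law \<open>(m a) \<alpha>(p) = \<chi>(m) (a p)\<close> of the right action, on \<open>m = a' \<otimes> c\<close>, is compatibility of
  \<open>\<psi>\<close> with the product of \<open>A\<close> followed by Hom-associativity.\<close>

lemma ract_assoc: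
  assumes m: "m \<in> carrier AC" and a: "a \<in> carrier A" and p: "p \<in> carrier A"
  shows "ract (ract m a) (\<alpha> p) = ract (\<chi> m) (a \<otimes>\<^bsub>A\<^esub> p)"
proof (rule tensor_linear_eqI[OF module_A module_C module_AC _ _ _ m])
  note R = bilinear_left[OF ract_bilinear]
  have ap: "a \<otimes>\<^bsub>A\<^esub> p \<in> carrier A" "\<alpha> p \<in> carrier A" using a p by auto
  show "(\<lambda>m. ract (ract m a) (\<alpha> p)) \<in> linear_maps K AC AC"
    by (rule linear_compose[OF R[OF ap(2)] R[OF a]])
  show "(\<lambda>m. ract (\<chi> m) (a \<otimes>\<^bsub>A\<^esub> p)) \<in> linear_maps K AC AC"
    by (rule linear_compose[OF R[OF ap(1)] chi_linear])
  fix a' c assume ac: "a' \<in> carrier A" "c \<in> carrier C"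
  have step: "ract (tens K A C (a' \<otimes>\<^bsub>A\<^esub> x) (\<gamma> u)) (\<alpha> p)
      = sum_entwine AC (\<lambda>y v. tens K A C (\<alpha> a' \<otimes>\<^bsub>A\<^esub> (x \<otimes>\<^bsub>A\<^esub> y)) (\<gamma> (\<gamma> v))) u (\<alpha>i p)"
    if xu: "x \<in> carrier A" "u \<in> carrier C" for x u
  proof -
    have "ract (tens K A C (a' \<otimes>\<^bsub>A\<^esub> x) (\<gamma> u)) (\<alpha> p)
        = sum_entwine AC (\<lambda>y v. tens K A C ((a' \<otimes>\<^bsub>A\<^esub> x) \<otimes>\<^bsub>A\<^esub> y) (\<gamma> v)) (\<gamma> u) (\<alpha> (\<alpha>i p))"
      using ac xu p by (simp add: ract_tens)
    also have "\<dots> = sum_entwine AC (\<lambda>y v. tens K A C ((a' \<otimes>\<^bsub>A\<^esub> x) \<otimes>\<^bsub>A\<^esub> \<alpha> y) (\<gamma> (\<gamma> v))) u (\<alpha>i p)"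
      by (rule entwine_aut_sum | assumption | rule rules ac xu p)+
    also have "\<dots> = sum_entwine AC (\<lambda>y v. tens K A C (\<alpha> a' \<otimes>\<^bsub>A\<^esub> (x \<otimes>\<^bsub>A\<^esub> y)) (\<gamma> (\<gamma> v))) u (\<alpha>i p)"
      by (rule tensor_lift_cong arg_cong[OF alg.hom_assoc[symmetric]] | assumption | rule rules ac xu p)+
    finally show ?thesis .
  qed
  note push = linear_tensor_lift_cong[OF _ _ _ _ R[OF ap(2)]]
  have "ract (ract (tens K A C a' c) a) (\<alpha> p) = sum_entwine AC (\<lambda>x u.
      sum_entwine AC (\<lambda>y v. tens K A C (\<alpha> a' \<otimes>\<^bsub>A\<^esub> (x \<otimes>\<^bsub>A\<^esub> y)) (\<gamma> (\<gamma> v))) u (\<alpha>i p)) c (\<alpha>i a)"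
    unfolding ract_tens[OF a ac]
    by (rule push step | assumption | rule rules ac a p)+
  also have "\<dots> = sum_entwine AC (\<lambda>x u. tens K A C (\<alpha> a' \<otimes>\<^bsub>A\<^esub> x) (\<gamma> u)) (\<gamma> c) (\<alpha>i a \<otimes>\<^bsub>A\<^esub> \<alpha>i p)"
    by (rule entwine_mult_sum[symmetric] | assumption | rule rules ac a p)+
  also have "\<alpha>i a \<otimes>\<^bsub>A\<^esub> \<alpha>i p = \<alpha>i (a \<otimes>\<^bsub>A\<^esub> p)"
    using a p alg.aut_mult[of "\<alpha>i a" "\<alpha>i p"] alphai_alpha[of "\<alpha>i a \<otimes>\<^bsub>A\<^esub> \<alpha>i p"] by simp
  also have "sum_entwine AC (\<lambda>x u. tens K A C (\<alpha> a' \<otimes>\<^bsub>A\<^esub> x) (\<gamma> u)) (\<gamma> c) (\<alpha>i (a \<otimes>\<^bsub>A\<^esub> p))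
      = ract (\<chi> (tens K A C a' c)) (a \<otimes>\<^bsub>A\<^esub> p)"
    using ac a p by (simp add: chi_tens ract_tens)
  finally show "ract (ract (tens K A C a' c) a) (\<alpha> p) = ract (\<chi> (tens K A C a' c)) (a \<otimes>\<^bsub>A\<^esub> p)" .
qed

lemma coring_tensor_over: "tensor_over_data K A AC \<chi> ract AC \<chi> lact"
  by (rule tensor_over_data.intro module_AC bilinear_closed[OF ract_bilinear] linear_closed[OF lact_linear]
      linear_closed[OF chi_linear] chi_inv_closed | assumption)+

abbreviation SQ where "SQ \<equiv> coring_square K A \<alpha> C \<gamma> \<psi>"

lemma module_SQ: "module K SQ"
  unfolding coring_square_def by (rule tensor_over_data.tensor_over_module[OF coring_tensor_over])

lemma coring_tens_bilinear: "coring_tens K A \<alpha> C \<gamma> \<psi> \<in> bilinear_maps K AC AC SQ"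
  unfolding coring_square_def coring_tens_def
  by (rule tensor_over_data.tens_over_bilinear[OF coring_tensor_over])

abbreviation \<Delta>\<^sub>C where "\<Delta>\<^sub>C \<equiv> coring_comult K A \<alpha> C \<gamma> \<Delta> \<psi>"

lemmas SQ_rules = module_SQ bilinear_closed[OF coring_tens_bilinear]
  linear_bilinear_left[OF coring_tens_bilinear] linear_bilinear_right[OF coring_tens_bilinear]

lemma coring_comult_linear: "\<Delta>\<^sub>C \<in> linear_maps K AC SQ"
  and coring_comult_tens: "\<lbrakk>a \<in> carrier A; c \<in> carrier C\<rbrakk> \<Longrightarrow> \<Delta>\<^sub>C (tens K A C a c)
    = sum_comult SQ (\<lambda>c1 c2. coring_tens K A \<alpha> C \<gamma> \<psi> (tens K A C (\<alpha>i a) c1) (tens K A C \<one>\<^bsub>A\<^esub> c2)) c"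
  unfolding coring_comult_def
  by (rule tensor_lift_linear tensor_lift_tens | assumption | rule rules SQ_rules)+

lemma dual_carrier: "\<xi> \<in> carrier D \<longleftrightarrow> \<xi> \<in> linear_maps K AC A
    \<and> (\<forall>x\<in>carrier AC. \<alpha> (\<xi> x) = \<xi> (\<chi> x)) \<and> \<xi> \<in> extensional (carrier AC)
    \<and> (\<forall>a\<in>carrier A. \<forall>x\<in>carrier AC. \<xi> (lact a x) = a \<otimes>\<^bsub>A\<^esub> \<xi> x)"
  by (auto simp: left_dual_algebra_def hom_morphisms_def)

lemma dual_ops:
  assumes "x \<in> carrier AC"
  shows "(\<xi> \<oplus>\<^bsub>D\<^esub> \<xi>') x = \<xi> x \<oplus>\<^bsub>A\<^esub> \<xi>' x" and "(r \<odot>\<^bsub>D\<^esub> \<xi>) x = r \<odot>\<^bsub>A\<^esub> \<xi> x"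
    and "\<zero>\<^bsub>D\<^esub> x = \<zero>\<^bsub>A\<^esub>" and "\<one>\<^bsub>D\<^esub> x = coring_counit K A \<alpha> C \<epsilon> x"
    and "(\<xi> \<otimes>\<^bsub>D\<^esub> \<xi>') x = tensor_over_lift K AC AC A (\<lambda>x1 x2. \<xi> (ract x1 (\<xi>' x2))) (\<Delta>\<^sub>C x)"
  using assms by (simp_all add: left_dual_algebra_def)

lemma dual_extensional:
  "\<xi> \<oplus>\<^bsub>D\<^esub> \<xi>' \<in> extensional (carrier AC)" "r \<odot>\<^bsub>D\<^esub> \<xi> \<in> extensional (carrier AC)"
  "\<zero>\<^bsub>D\<^esub> \<in> extensional (carrier AC)" "\<one>\<^bsub>D\<^esub> \<in> extensional (carrier AC)"
  "\<xi> \<otimes>\<^bsub>D\<^esub> \<xi>' \<in> extensional (carrier AC)"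
  by (simp_all add: left_dual_algebra_def)

lemma dual_product_bilinear:
  assumes \<xi>: "\<xi> \<in> carrier D" and \<xi>': "\<xi>' \<in> carrier D"
  shows "(\<lambda>x1 x2. \<xi> (ract x1 (\<xi>' x2))) \<in> bilinear_maps K AC AC A"
proof -
  from \<xi> \<xi>' have lin: "\<xi> \<in> linear_maps K AC A" "\<xi>' \<in> linear_maps K AC A"
    by (simp_all add: dual_carrier)
  show ?thesis
    by (rule bilinear_mapsI linear_compose[OF lin(1)] linear_bilinear_left[OF ract_bilinear]
        linear_bilinear_right[OF ract_bilinear] linear_closed[OF lin(2)] lin linear_ident | assumption)+
qed

text \<open>Put \<open>n = \<chi>(n')\<close>.  Then \<open>\<xi>'(n) = \<alpha>(\<xi>'(n'))\<close> and \<open>\<xi>'(a n') = a \<xi>'(n')\<close>, so the claim is the Hom-module law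
  of the right action with \<open>p = \<xi>'(n')\<close>.\<close>

lemma dual_product_balanced:
  assumes \<xi>: "\<xi> \<in> carrier D" and \<xi>': "\<xi>' \<in> carrier D"
    and m: "m \<in> carrier AC" and a: "a \<in> carrier A" and n: "n \<in> carrier AC"
  shows "\<xi> (ract (ract m a) (\<xi>' n)) = \<xi> (ract (\<chi> m) (\<xi>' (lact a (aut_inv AC \<chi> n))))"
proof -
  let ?n = "aut_inv AC \<chi> n"
  from \<xi>' have lin: "\<xi>' \<in> linear_maps K AC A" by (simp add: dual_carrier)
  have n': "?n \<in> carrier AC" "\<chi> ?n = n" by (rule chi_inv_closed[OF n] chi_chi_inv[OF n])+
  have "\<xi>' n = \<alpha> (\<xi>' ?n)" "\<xi>' (lact a ?n) = a \<otimes>\<^bsub>A\<^esub> \<xi>' ?n"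
    using \<xi>' n' a by (simp_all add: dual_carrier)
  then show ?thesis
    by (simp add: ract_assoc[OF m a linear_closed[OF lin n'(1)]])
qed

lemma
  assumes "\<xi> \<in> carrier D" "\<xi>' \<in> carrier D"
  shows dual_product_linear: "tensor_over_lift K AC AC A (\<lambda>x1 x2. \<xi> (ract x1 (\<xi>' x2)))
      \<in> linear_maps K SQ A"
    and dual_product_tens: "\<lbrakk>m \<in> carrier AC; n \<in> carrier AC\<rbrakk>
      \<Longrightarrow> tensor_over_lift K AC AC A (\<lambda>x1 x2. \<xi> (ract x1 (\<xi>' x2))) (coring_tens K A \<alpha> C \<gamma> \<psi> m n)
        = \<xi> (ract m (\<xi>' n))"
  unfolding coring_square_def coring_tens_def
  by (rule tensor_over_data.tensor_over_lift_linear[OF coring_tensor_over]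
      tensor_over_data.tensor_over_lift_tens[OF coring_tensor_over]
      module_A dual_product_bilinear dual_product_balanced assms | assumption)+


section \<open>The anti-isomorphism\<close>

definition extend where
  "extend f = restrict (tensor_lift K A C A (\<lambda>a c. a \<otimes>\<^bsub>A\<^esub> f c)) (carrier AC)"

lemma extend_bilinear:
  assumes "f \<in> linear_maps K C A"
  shows "(\<lambda>a c. a \<otimes>\<^bsub>A\<^esub> f c) \<in> bilinear_maps K A C A"
  by (rule twisted_inner_bilinear[OF assms assms])

lemma extend_linear: "f \<in> linear_maps K C A \<Longrightarrow> extend f \<in> linear_maps K AC A"
  unfolding extend_def
  by (intro linear_restrict module_AC tensor_lift_linear module_A module_C extend_bilinear)

lemma extend_tens: "\<lbrakk>f \<in> linear_maps K C A; a \<in> carrier A; c \<in> carrier C\<rbrakk>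
    \<Longrightarrow> extend f (tens K A C a c) = a \<otimes>\<^bsub>A\<^esub> f c"
  unfolding extend_def
  by (simp add: tens_closed module_A module_C tensor_lift_tens extend_bilinear)

lemma extend_eqI:
  assumes "f \<in> linear_maps K C A" "\<xi> \<in> linear_maps K AC A" "\<xi> \<in> extensional (carrier AC)"
    and "\<And>a c. \<lbrakk>a \<in> carrier A; c \<in> carrier C\<rbrakk> \<Longrightarrow> a \<otimes>\<^bsub>A\<^esub> f c = \<xi> (tens K A C a c)"
  shows "extend f = \<xi>"
proof (rule extensionalityI)
  show "extend f \<in> extensional (carrier AC)" by (simp add: extend_def)
  show "extend f x = \<xi> x" if "x \<in> carrier AC" for x
    by (rule tensor_linear_eqI[OF module_A module_C module_A extend_linear[OF assms(1)] assms(2) _ that])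
      (simp add: extend_tens assms)
qed (rule assms)

text \<open>Left linearity is Hom-associativity: \<open>(\<alpha>\<^sup>-\<^sup>1(a) a') f(\<gamma>(c)) = (\<alpha>\<^sup>-\<^sup>1(a) a') \<alpha>(f(c)) = a (a' f(c))\<close>.\<close>

lemma extend_closed:
  assumes f: "f \<in> carrier H"
  shows "extend f \<in> carrier D"
proof -
  note fl = koppinen_linear[OF f]
  note E = extend_linear[OF fl] and Et = extend_tens[OF fl]
  note [simp] = linear_closed[OF fl]
  have "\<alpha> (extend f x) = extend f (\<chi> x)" if "x \<in> carrier AC" for x
    by (rule tensor_linear_eqI[OF module_A module_C module_A linear_compose[OF alg.aut_linear E]
          linear_compose[OF E chi_linear] _ that])
      (simp add: Et chi_tens alg.aut_mult koppinen_aut[OF f])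
  moreover have "extend f (lact a x) = a \<otimes>\<^bsub>A\<^esub> extend f x" if a: "a \<in> carrier A" and x: "x \<in> carrier AC" for a x
  proof (rule tensor_linear_eqI[OF module_A module_C module_A linear_compose[OF E lact_linear[OF a]]
        linear_compose[OF bilinear_right[OF alg.mult_bilinear a] E] _ x])
    fix a' c assume ac: "a' \<in> carrier A" "c \<in> carrier C"
    then show "extend f (lact a (tens K A C a' c)) = a \<otimes>\<^bsub>A\<^esub> extend f (tens K A C a' c)"
      using a alg.hom_assoc[of "\<alpha>i a" a' "f c"] by (simp add: Et lact_tens koppinen_aut[OF f])
  qed
  ultimately show ?thesis
    unfolding dual_carrier using E by (simp add: extend_def)
qed

text \<open>\<open>f\<close> can be read off at \<open>1 \<otimes> c\<close>, where the extension takes the value \<open>1 f(c) = \<alpha>(f(c))\<close>.\<close>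

lemma extend_inj: "inj_on extend (carrier H)"
proof (rule inj_onI, rule koppinen_eqI)
  fix f g c assume fg: "f \<in> carrier H" "g \<in> carrier H" "extend f = extend g" and c: "c \<in> carrier C"
  have "\<alpha> (f c) = \<alpha> (g c)"
    using fun_cong[OF fg(3), of "tens K A C \<one>\<^bsub>A\<^esub> c"] fg(1,2) c
    by (simp add: extend_tens koppinen_linear linear_closed[OF koppinen_linear] alg.hom_unit_left)
  then show "f c = g c"
    using fg c by (metis alphai_alpha koppinen_linear linear_closed)
qed

text \<open>For \<open>f(c) = \<alpha>\<^sup>-\<^sup>1(\<xi>(1 \<otimes> c)) = \<xi>(1 \<otimes> \<gamma>\<^sup>-\<^sup>1(c))\<close>, left linearity gives
  \<open>a f(c) = \<xi>(a (1 \<otimes> \<gamma>\<^sup>-\<^sup>1(c))) = \<xi>(\<alpha>\<^sup>-\<^sup>1(a) 1 \<otimes> c) = \<xi>(a \<otimes> c)\<close>.\<close>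

lemma extend_surj:
  assumes \<xi>: "\<xi> \<in> carrier D"
  shows "\<xi> \<in> extend ` carrier H"
proof -
  define f where "f = (\<lambda>c\<in>carrier C. \<alpha>i (\<xi> (tens K A C \<one>\<^bsub>A\<^esub> c)))"
  have lin: "\<xi> \<in> linear_maps K AC A" using \<xi> by (simp add: dual_carrier)
  have one_tens: "tens K A C \<one>\<^bsub>A\<^esub> c \<in> carrier AC" if "c \<in> carrier C" for c
    by (rule rules that)+
  have fl: "f \<in> linear_maps K C A"
    unfolding f_def
    by (rule linear_restrict linear_compose[OF alphai_linear] linear_compose[OF lin] | rule rules)+
  have aut: "\<alpha> (\<xi> (tens K A C \<one>\<^bsub>A\<^esub> c)) = \<xi> (tens K A C \<one>\<^bsub>A\<^esub> (\<gamma> c))" if "c \<in> carrier C" for c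
    using \<xi> one_tens[OF that] that by (simp add: dual_carrier chi_tens alg.aut_one)
  have f: "f \<in> carrier H"
    unfolding koppinen_carrier using fl linear_closed[OF lin one_tens]
    by (simp add: f_def flip: aut)
  have "a \<otimes>\<^bsub>A\<^esub> f c = \<xi> (tens K A C a c)" if ac: "a \<in> carrier A" "c \<in> carrier C" for a c
  proof -
    have "f c = \<xi> (tens K A C \<one>\<^bsub>A\<^esub> (\<gamma>i c))"
      using ac(2) linear_closed[OF lin one_tens, of "\<gamma>i c"] aut[of "\<gamma>i c"]
      by (simp add: f_def) (metis alphai_alpha)
    then have "a \<otimes>\<^bsub>A\<^esub> f c = \<xi> (lact a (tens K A C \<one>\<^bsub>A\<^esub> (\<gamma>i c)))"
      using \<xi> ac one_tens by (simp add: dual_carrier)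
    also have "\<dots> = \<xi> (tens K A C a c)"
      using ac by (simp add: lact_tens alg.hom_unit_right)
    finally show ?thesis .
  qed
  then have "extend f = \<xi>"
    using \<xi> by (intro extend_eqI fl lin) (auto simp: dual_carrier)
  with f show ?thesis by blast
qed

text \<open>Both sides are linear, so they are compared at \<open>a \<otimes> c\<close>.  There \<open>x\<^sub>2 = 1 \<otimes> c\<^sub>2\<close>, where the extension of \<open>f\<close>
  takes the value \<open>\<alpha>(f(c\<^sub>2))\<close>, and this \<open>\<alpha>\<close> cancels the \<open>\<alpha>\<^sup>-\<^sup>1\<close> in the right action of the coring.\<close>

lemma extend_mult:
  assumes f: "f \<in> carrier H" and g: "g \<in> carrier H"
  shows "extend (f \<otimes>\<^bsub>H\<^esub> g) = extend g \<otimes>\<^bsub>D\<^esub> extend f"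
proof (rule extend_eqI)
  note fl = koppinen_linear[OF f] and gl = koppinen_linear[OF g]
  note r = rules linear_compose[OF fl] linear_closed[OF fl] linear_compose[OF gl] linear_closed[OF gl]
  let ?L = "tensor_over_lift K AC AC A (\<lambda>x1 x2. extend g (ract x1 (extend f x2)))"
  note L = dual_product_linear[OF extend_closed[OF g] extend_closed[OF f]]
    and L_tens = dual_product_tens[OF extend_closed[OF g] extend_closed[OF f]]
  show "f \<otimes>\<^bsub>H\<^esub> g \<in> linear_maps K C A"
    by (rule koppinen_linear[OF koppinen_mult_closed[OF f g]])
  show "extend g \<otimes>\<^bsub>D\<^esub> extend f \<in> linear_maps K AC A"
    by (rule linear_cong[OF module_AC _ linear_compose[OF L coring_comult_linear]])
      (simp add: dual_ops)
  show "extend g \<otimes>\<^bsub>D\<^esub> extend f \<in> extensional (carrier AC)"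
    by (rule dual_extensional)
  fix a c assume ac: "a \<in> carrier A" "c \<in> carrier C"
  have summand: "extend g (tens K A C (\<alpha>i a \<otimes>\<^bsub>A\<^esub> x) (\<gamma> u)) = a \<otimes>\<^bsub>A\<^esub> (x \<otimes>\<^bsub>A\<^esub> g u)"
    if "x \<in> carrier A" "u \<in> carrier C" for x u
    using alg.hom_assoc[of "\<alpha>i a" x "g u"] that ac
    by (simp add: extend_tens[OF gl] linear_closed[OF gl] koppinen_aut[OF g])
  have inner: "?L (coring_tens K A \<alpha> C \<gamma> \<psi> (tens K A C (\<alpha>i a) c1) (tens K A C \<one>\<^bsub>A\<^esub> c2))
      = sum_entwine A (\<lambda>x u. a \<otimes>\<^bsub>A\<^esub> (x \<otimes>\<^bsub>A\<^esub> g u)) c1 (f c2)"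
    if c12: "c1 \<in> carrier C" "c2 \<in> carrier C" for c1 c2
  proof -
    have "?L (coring_tens K A \<alpha> C \<gamma> \<psi> (tens K A C (\<alpha>i a) c1) (tens K A C \<one>\<^bsub>A\<^esub> c2))
        = extend g (ract (tens K A C (\<alpha>i a) c1) (extend f (tens K A C \<one>\<^bsub>A\<^esub> c2)))"
      by (rule L_tens rules ac c12)+
    also have "\<dots> = extend g (sum_entwine AC (\<lambda>x u. tens K A C (\<alpha>i a \<otimes>\<^bsub>A\<^esub> x) (\<gamma> u)) c1 (f c2))"
      using ac c12 by (simp add: extend_tens[OF fl] linear_closed[OF fl] alg.hom_unit_left ract_tens)
    also have "\<dots> = sum_entwine A (\<lambda>x u. a \<otimes>\<^bsub>A\<^esub> (x \<otimes>\<^bsub>A\<^esub> g u)) c1 (f c2)"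
      by (rule linear_tensor_lift_cong[OF _ _ _ _ extend_linear[OF gl]] summand | assumption
          | rule r ac c12)+
    finally show ?thesis .
  qed
  have "(extend g \<otimes>\<^bsub>D\<^esub> extend f) (tens K A C a c) = ?L (\<Delta>\<^sub>C (tens K A C a c))"
    by (rule dual_ops) (rule rules ac)+
  also have "\<dots> = sum_comult A (\<lambda>c1 c2. sum_entwine A (\<lambda>x u. a \<otimes>\<^bsub>A\<^esub> (x \<otimes>\<^bsub>A\<^esub> g u)) c1 (f c2)) c"
    unfolding coring_comult_tens[OF ac]
    by (rule linear_tensor_lift_cong[OF _ _ _ _ L] inner | assumption | rule r SQ_rules ac)+
  also have "\<dots> = a \<otimes>\<^bsub>A\<^esub> twisted f g c"
    by (rule linear_tensor_lift_cong[OF _ _ _ _ bilinear_right[OF alg.mult_bilinear ac(1)], symmetric]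
        linear_tensor_lift_cong[OF _ _ _ _ bilinear_right[OF alg.mult_bilinear ac(1)]] refl | assumption | rule r ac)+
  finally show "a \<otimes>\<^bsub>A\<^esub> (f \<otimes>\<^bsub>H\<^esub> g) c = (extend g \<otimes>\<^bsub>D\<^esub> extend f) (tens K A C a c)"
    using ac by (simp add: koppinen_ops)
qed

lemma extend_one: "extend \<one>\<^bsub>H\<^esub> = \<one>\<^bsub>D\<^esub>"
proof (rule extend_eqI[OF koppinen_linear[OF koppinen_closed(4)] _ dual_extensional(4)])
  have bil: "(\<lambda>a c. \<epsilon> c \<odot>\<^bsub>A\<^esub> \<alpha> a) \<in> bilinear_maps K A C A"
    by (rule linear_scale | rule rules counit_closed | assumption)+
  show "\<one>\<^bsub>D\<^esub> \<in> linear_maps K AC A"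
    by (rule linear_cong[OF module_AC _ tensor_lift_linear[OF module_A module_C module_A bil]])
      (simp add: dual_ops coring_counit_def)
  fix a c assume ac: "a \<in> carrier A" "c \<in> carrier C"
  have "\<one>\<^bsub>D\<^esub> (tens K A C a c) = \<epsilon> c \<odot>\<^bsub>A\<^esub> \<alpha> a"
    using tensor_lift_tens[OF module_A module_C module_A bil ac] tens_closed[OF module_A module_C ac]
    by (simp add: dual_ops coring_counit_def)
  then show "a \<otimes>\<^bsub>A\<^esub> \<one>\<^bsub>H\<^esub> c = \<one>\<^bsub>D\<^esub> (tens K A C a c)"
    using ac by (simp add: koppinen_ops alg.hom_unit_right
        linear_smult[OF bilinear_right[OF alg.mult_bilinear]])
qed

lemma extend_zero: "extend \<zero>\<^bsub>H\<^esub> = \<zero>\<^bsub>D\<^esub>"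
proof (rule extend_eqI[OF koppinen_linear[OF koppinen_closed(3)] _ dual_extensional(3)])
  have zero: "(\<lambda>x. \<zero>\<^bsub>A\<^esub>) \<in> linear_maps K AC A"
    by (rule linear_mapsI) auto
  show "\<zero>\<^bsub>D\<^esub> \<in> linear_maps K AC A"
    by (rule linear_cong[OF module_AC _ zero]) (simp add: dual_ops)
  show "a \<otimes>\<^bsub>A\<^esub> \<zero>\<^bsub>H\<^esub> c = \<zero>\<^bsub>D\<^esub> (tens K A C a c)" if "a \<in> carrier A" "c \<in> carrier C" for a c
    using that by (simp add: koppinen_ops dual_ops tens_closed module_A module_C
        linear_zero[OF module_A module_A bilinear_right[OF alg.mult_bilinear]])
qed

lemma extend_add:
  assumes f: "f \<in> carrier H" and g: "g \<in> carrier H"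
  shows "extend (f \<oplus>\<^bsub>H\<^esub> g) = extend f \<oplus>\<^bsub>D\<^esub> extend g"
proof (rule extend_eqI[OF koppinen_linear[OF koppinen_closed(1)[OF f g]] _ dual_extensional(1)])
  note fl = koppinen_linear[OF f] and gl = koppinen_linear[OF g]
  show "extend f \<oplus>\<^bsub>D\<^esub> extend g \<in> linear_maps K AC A"
    by (rule linear_cong[OF module_AC _ linear_plus[OF module_A extend_linear[OF fl] extend_linear[OF gl]]])
      (simp add: dual_ops)
  show "a \<otimes>\<^bsub>A\<^esub> (f \<oplus>\<^bsub>H\<^esub> g) c = (extend f \<oplus>\<^bsub>D\<^esub> extend g) (tens K A C a c)"
    if "a \<in> carrier A" "c \<in> carrier C" for a c
    using that by (simp add: koppinen_ops dual_ops tens_closed module_A module_C extend_tens fl gl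
        linear_closed[OF fl] linear_closed[OF gl] linear_add[OF bilinear_right[OF alg.mult_bilinear]])
qed

lemma extend_smult:
  assumes rK: "r \<in> carrier K" and f: "f \<in> carrier H"
  shows "extend (r \<odot>\<^bsub>H\<^esub> f) = r \<odot>\<^bsub>D\<^esub> extend f"
proof (rule extend_eqI[OF koppinen_linear[OF koppinen_closed(2)[OF rK f]] _ dual_extensional(2)])
  note fl = koppinen_linear[OF f]
  show "r \<odot>\<^bsub>D\<^esub> extend f \<in> linear_maps K AC A"
    by (rule linear_cong[OF module_AC _ linear_scale[OF module_A rK extend_linear[OF fl]]])
      (simp add: dual_ops)
  show "a \<otimes>\<^bsub>A\<^esub> (r \<odot>\<^bsub>H\<^esub> f) c = (r \<odot>\<^bsub>D\<^esub> extend f) (tens K A C a c)"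
    if "a \<in> carrier A" "c \<in> carrier C" for a c
    using that rK by (simp add: koppinen_ops dual_ops tens_closed module_A module_C extend_tens fl
        linear_closed[OF fl] linear_smult[OF bilinear_right[OF alg.mult_bilinear]])
qed

lemma extend_bij: "bij_betw extend (carrier H) (carrier D)"
  unfolding bij_betw_def using extend_inj extend_closed extend_surj by blast

end

theorem theorem3p9:
  fixes K :: "'k ring" and A :: "('k, 'a) module" and \<alpha> :: "'a \<Rightarrow> 'a"
    and C :: "('k, 'c) module" and \<gamma> :: "'c \<Rightarrow> 'c"
    and \<Delta> :: "'c \<Rightarrow> ('c \<times> 'c \<Rightarrow> 'k) set" and \<epsilon> :: "'c \<Rightarrow> 'k"
    and \<psi> :: "('c \<times> 'a \<Rightarrow> 'k) set \<Rightarrow> ('a \<times> 'c \<Rightarrow> 'k) set"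
  assumes "hom_entwining K A \<alpha> C \<gamma> \<Delta> \<epsilon> \<psi>"
  shows "assoc_unital_algebra K (koppinen_smash K A \<alpha> C \<gamma> \<Delta> \<epsilon> \<psi>)
    \<and> assoc_unital_algebra K (left_dual_algebra K A \<alpha> C \<gamma> \<Delta> \<epsilon> \<psi>)
    \<and> (\<exists>\<Phi>. \<Phi> \<in> algebra_anti_iso K (koppinen_smash K A \<alpha> C \<gamma> \<Delta> \<epsilon> \<psi>)
                                  (left_dual_algebra K A \<alpha> C \<gamma> \<Delta> \<epsilon> \<psi>))"
proof -
  interpret hom_entwining K A \<alpha> C \<gamma> \<Delta> \<epsilon> \<psi> by fact
  note transport = assoc_unital_algebra_anti_transport[OF koppinen_algebra extend_bij,
      OF extend_zero extend_one]
  have "assoc_unital_algebra K D"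
    by (rule transport(1)) (simp_all add: extend_add extend_smult extend_mult)
  moreover have "extend \<in> algebra_anti_iso K H D"
    by (rule transport(2)) (simp_all add: extend_add extend_smult extend_mult)
  ultimately show ?thesis
    using koppinen_algebra by blast
qed

end
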